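(* Fix $\beta\in(0,1)$ and assume $M=M(N)\to\infty$ with $M=o(\sqrt N)$ as $N\to\infty$. Let $k=k(N)$ satisfy $k/N\to\rho\in(0,1)$. Let $\mu_N^{(k)}$ be the marginal on $(\sigma_1,\dots,\sigma_k)$ of the Hopfield Gibbs measure $\mu_N$ at inverse temperature $\beta$ with $N$ spins and $M(N)$ patterns, and let $\pi$ be the Rademacher law on $\{-1,+1\}$. Then, in $\mathbb P_\xi$-probability, $$d_{\mathrm{TV}}\big(\mu_N^{(k)},\pi^{\otimes k}\big)\longrightarrow 1.$$
   Context: Hopfield model: for each $N$, with $M=M(N)$, let $\xi_i=(\xi_i^1,\dots,\xi_i^M)\in\{-1,+1\}^M$, $i=1,\dots,N$, be i.i.d. random vectors with independent coordinates, $\mathbb E[\xi_i^\nu]=0$ and $\mathbb E[(\xi_i^\nu)^2]=1$; $\mathbb P_\xi$ denotes their law (the disorder). For $\sigma\in\{-1,+1\}^N$ put $m_N(\sigma)=\frac1N\sum_{i=1}^N\sigma_i\xi_i\in\mathbb R^M$. For fixed $\xi$ and $\beta>0$ the Gibbs measure on $\{-1,+1\}^N$ is $\mu_N(\sigma)=\frac1{Z_N}\exp\big(\frac{\beta N}{2}\|m_N(\sigma)\|^2\big)$, where $\|\cdot\|$ is the Euclidean norm and $Z_N$ the normalizing constant; it is a random measure, depending on $\xi$. $\pi(\pm1)=\frac12$. $d_{\mathrm{TV}}(\nu,\varrho)=\sup_A|\nu(A)-\varrho(A)|$. *)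

theory Defs
  imports "HOL-Probability.Probability" "HOL-Library.Landau_Symbols"
begin

text \<open>
  Spin configurations and pattern vectors are extensional functions on \<open>{1..n}\<close>
  with values in the reals \<open>-1, 1\<close>.
\<close>

definition spin_configs :: "nat \<Rightarrow> (nat \<Rightarrow> real) set" where
  "spin_configs n = {1..n} \<rightarrow>\<^sub>E {-1, 1}"

text \<open>
  \<open>xi i \<omega> \<nu>\<close> is the coordinate \<open>\<nu>\<close> of the random vector \<open>xi i\<close>.  Measurability with respect
  to \<open>count_space {-1, 1}\<close>, which is part of \<open>indep_vars\<close>, includes that the values
  lie in \<open>{-1, 1}\<close>.
\<close>

definition hopfield_disorder ::
  "nat \<Rightarrow> nat \<Rightarrow> 'a measure \<Rightarrow> (nat \<Rightarrow> 'a \<Rightarrow> nat \<Rightarrow> real) \<Rightarrow> bool" where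
  "hopfield_disorder N M P xi \<longleftrightarrow>
     prob_space P \<and>
     prob_space.indep_vars P (\<lambda>i. PiM {1..M} (\<lambda>\<nu>. count_space {-1, 1})) xi {1..N} \<and>
     (\<forall>i\<in>{1..N}. \<forall>j\<in>{1..N}.
        distr P (PiM {1..M} (\<lambda>\<nu>. count_space {-1, 1})) (xi i) =
        distr P (PiM {1..M} (\<lambda>\<nu>. count_space {-1, 1})) (xi j)) \<and>
     (\<forall>i\<in>{1..N}.
        prob_space.indep_vars P (\<lambda>\<nu>. count_space {-1, 1}) (\<lambda>\<nu> \<omega>. xi i \<omega> \<nu>) {1..M}) \<and>
     (\<forall>i\<in>{1..N}. \<forall>\<nu>\<in>{1..M}.
        (\<integral>\<omega>. xi i \<omega> \<nu> \<partial>P) = 0 \<and> (\<integral>\<omega>. (xi i \<omega> \<nu>)\<^sup>2 \<partial>P) = 1)"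

definition overlap :: "nat \<Rightarrow> (nat \<Rightarrow> nat \<Rightarrow> real) \<Rightarrow> (nat \<Rightarrow> real) \<Rightarrow> nat \<Rightarrow> real" where
  "overlap N x \<sigma> \<nu> = (1 / real N) * (\<Sum>i=1..N. \<sigma> i * x i \<nu>)"

definition gibbs_weight ::
  "real \<Rightarrow> nat \<Rightarrow> nat \<Rightarrow> (nat \<Rightarrow> nat \<Rightarrow> real) \<Rightarrow> (nat \<Rightarrow> real) \<Rightarrow> real" where
  "gibbs_weight \<beta> N M x \<sigma> = exp (\<beta> * real N / 2 * (L2_set (overlap N x \<sigma>) {1..M})\<^sup>2)"

definition partition_function :: "real \<Rightarrow> nat \<Rightarrow> nat \<Rightarrow> (nat \<Rightarrow> nat \<Rightarrow> real) \<Rightarrow> real" where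
  "partition_function \<beta> N M x = (\<Sum>\<sigma>\<in>spin_configs N. gibbs_weight \<beta> N M x \<sigma>)"

definition gibbs_measure ::
  "real \<Rightarrow> nat \<Rightarrow> nat \<Rightarrow> (nat \<Rightarrow> nat \<Rightarrow> real) \<Rightarrow> (nat \<Rightarrow> real) pmf" where
  "gibbs_measure \<beta> N M x = embed_pmf (\<lambda>\<sigma>.
     if \<sigma> \<in> spin_configs N then gibbs_weight \<beta> N M x \<sigma> / partition_function \<beta> N M x else 0)"

lemma finite_spin_configs: "finite (spin_configs n)"
  by (auto simp: spin_configs_def intro!: finite_PiE)

lemma spin_configs_nonempty: "spin_configs n \<noteq> {}"
  by (simp add: spin_configs_def PiE_eq_empty_iff)

lemma partition_function_pos: "partition_function \<beta> N M x > 0"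
  unfolding partition_function_def gibbs_weight_def
  by (intro sum_pos) (simp_all add: finite_spin_configs spin_configs_nonempty)

lemma pmf_gibbs_measure:
  "pmf (gibbs_measure \<beta> N M x) \<sigma> =
     (if \<sigma> \<in> spin_configs N then gibbs_weight \<beta> N M x \<sigma> / partition_function \<beta> N M x else 0)"
  unfolding gibbs_measure_def
proof (rule pmf_embed_pmf)
  let ?f = "\<lambda>\<sigma>. if \<sigma> \<in> spin_configs N
     then gibbs_weight \<beta> N M x \<sigma> / partition_function \<beta> N M x else 0"
  show nonneg: "?f \<tau> \<ge> 0" for \<tau>
    using partition_function_pos[of \<beta> N M x] by (auto simp: gibbs_weight_def)
  have "(\<integral>\<^sup>+\<tau>. ennreal (?f \<tau>) \<partial>count_space UNIV) = (\<Sum>\<tau>\<in>spin_configs N. ennreal (?f \<tau>))"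
    by (intro nn_integral_count_space') (auto simp: finite_spin_configs)
  also have "\<dots> = ennreal (\<Sum>\<tau>\<in>spin_configs N. ?f \<tau>)"
    using nonneg by (intro sum_ennreal)
  also have "(\<Sum>\<tau>\<in>spin_configs N. ?f \<tau>) = 1"
    using partition_function_pos[of \<beta> N M x]
    by (simp add: sum_divide_distrib[symmetric] partition_function_def)
  finally show "(\<integral>\<^sup>+\<tau>. ennreal (?f \<tau>) \<partial>count_space UNIV) = 1" by simp
qed

text \<open>The marginal on the first \<open>k\<close> spins is meaningful for \<open>k \<le> N\<close>.\<close>

definition gibbs_marginal ::
  "real \<Rightarrow> nat \<Rightarrow> nat \<Rightarrow> nat \<Rightarrow> (nat \<Rightarrow> nat \<Rightarrow> real) \<Rightarrow> (nat \<Rightarrow> real) pmf" where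
  "gibbs_marginal \<beta> N M k x = map_pmf (\<lambda>\<sigma>. restrict \<sigma> {1..k}) (gibbs_measure \<beta> N M x)"

definition rademacher :: "real pmf" where
  "rademacher = pmf_of_set {-1, 1}"

text \<open>The default value \<open>undefined\<close> makes the samples extensional.\<close>

definition rademacher_product :: "nat \<Rightarrow> (nat \<Rightarrow> real) pmf" where
  "rademacher_product k = Pi_pmf {1..k} undefined (\<lambda>_. rademacher)"

definition tv_dist :: "'b pmf \<Rightarrow> 'b pmf \<Rightarrow> real" where
  "tv_dist p q = (SUP A. \<bar>measure_pmf.prob p A - measure_pmf.prob q A\<bar>)"

text \<open>
  Convergence in probability to a constant, where the \<open>n\<close>-th variable may live on its own
  probability space.  Measurability is required because \<open>measure\<close> vanishes on
  non-measurable sets.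
\<close>

definition tendsto_in_prob ::
  "(nat \<Rightarrow> 'a measure) \<Rightarrow> (nat \<Rightarrow> 'a \<Rightarrow> real) \<Rightarrow> real \<Rightarrow> bool" where
  "tendsto_in_prob P X c \<longleftrightarrow>
     (\<forall>n. X n \<in> borel_measurable (P n)) \<and>
     (\<forall>\<epsilon>>0. (\<lambda>n. measure (P n) {\<omega> \<in> space (P n). \<bar>X n \<omega> - c\<bar> > \<epsilon>}) \<longlonglongrightarrow> 0)"

end

theory Submission
  imports Defs "HOL-Real_Asymp.Real_Asymp"
begin

text \<open>
  The two laws are separated by the size of the partial sum \<open>S\<^sub>k = \<sigma>\<^sub>1 \<xi>\<^sub>1 + \<dots> + \<sigma>\<^sub>k \<xi>\<^sub>k\<close>:
  its squared norm is about \<open>k M\<close> under the product measure, but about \<open>k M / (1 - \<kappa>)\<close> with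
  \<open>\<kappa> = \<beta> \<rho> / (1 - \<beta> (1 - \<rho>))\<close> under the Gibbs measure.  Fix a level \<open>t k M\<close> in between.  Both error
  probabilities are exponentially small in \<open>M\<close> by Chernoff bounds, which require upper bounds on
  spin sums of exponentials of squared norms and a lower bound on the partition function.  Writing
  \<open>exp (c |S|\<^sup>2 / 2)\<close> as a Gaussian average of \<open>exp (sqrt c g \<bullet> S)\<close> turns the spin sums into products
  of \<open>cosh (sqrt c g \<bullet> \<xi>\<^sub>i)\<close>; then \<open>cosh y \<le> exp (y\<^sup>2 / 2)\<close>, and nearly the reverse inequality for
  small \<open>y\<close>, reduce everything to Gaussian integrals, provided the empirical covariance matrices of
  the patterns over the first \<open>k\<close>, the last \<open>N - k\<close> and all \<open>N\<close> sites are close to the identity.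
  The expected squared Frobenius distance to the identity is at most \<open>M\<^sup>2\<close> divided by the number of
  sites, so this holds with high probability since \<open>M = o (sqrt N)\<close>.
\<close>

subsection \<open>Gaussian integrals\<close>

text \<open>Both sides equal 1 at 0, and the affine side has the larger slope there. This supplies
  the Chernoff parameters and the lower bound on \<open>cosh\<close> near 0.\<close>

lemma eventually_exp_less_affine:
  fixes a t :: real
  assumes "t < a"
  shows "\<forall>\<^sub>F s in at_right 0. exp (t * s) < 1 + a * s"
proof -
  have "((\<lambda>s. 1 + a * s - exp (t * s)) has_real_derivative (a - t)) (at 0)"
    by (auto intro!: derivative_eq_intros)
  from DERIV_pos_inc_right[OF this] assms obtain d where "d > 0"
    and "\<And>h. h > 0 \<Longrightarrow> h < d \<Longrightarrow> 1 + a * 0 - exp (t * 0) < 1 + a * (0 + h) - exp (t * (0 + h))"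
    by auto
  then show ?thesis
    unfolding eventually_at_right_field by (intro exI[of _ d]) auto
qed

text \<open>\<open>cosh\<close> is the moment generating function of a Rademacher variable, so this
  is a case of Hoeffding's lemma; evenness reduces it to nonnegative arguments.\<close>

lemma cosh_le_exp_half_square:
  fixes y :: real
  shows "cosh y \<le> exp (y\<^sup>2 / 2)"
proof -
  have "cosh z \<le> exp (z\<^sup>2 / 2)" if "z \<ge> 0" for z :: real
  proof -
    \<comment> \<open>Hoeffding's inequality is taken with success probability 1/2 and exponent
      \<open>2 * z\<close>. Its logarithm then splits as \<open>z + ln (cosh z)\<close>, and the
      \<open>z\<close> cancels against the centring term.\<close>
    have c: "1 + 1 / 2 * (exp (2 * z) - 1) = exp z * cosh z"
      by (simp add: cosh_def field_simps flip: exp_add)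
    have "- (2 * z) * (1 / 2) + ln (1 + 1 / 2 * (exp (2 * z) - 1)) \<le> (2 * z)\<^sup>2 / 8"
      using that by (intro Hoeffdings_lemma_aux) auto
    then have "ln (cosh z) \<le> z\<^sup>2 / 2"
      unfolding c by (simp add: ln_mult power2_eq_square)
    then show ?thesis
      by (metis cosh_real_pos exp_le_cancel_iff exp_ln)
  qed
  from this[of "\<bar>y\<bar>"] show ?thesis by simp
qed

text \<open>The half-argument formula \<open>cosh y = 1 + 2 * (sinh (y / 2))\<^sup>2\<close> reduces
  the claim to \<open>z \<le> sinh z\<close> for nonnegative \<open>z\<close>, where
  \<open>sinh z - z\<close> has derivative \<open>cosh z - 1\<close>.\<close>

lemma one_plus_half_square_le_cosh:
  fixes y :: real
  shows "1 + y\<^sup>2 / 2 \<le> cosh y"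
proof -
  have "cosh y = 1 + 2 * (sinh (y / 2))\<^sup>2"
    using cosh_double[of "y / 2"] cosh_square_eq[of "y / 2"] by simp
  moreover have "(y / 2)\<^sup>2 \<le> (sinh (y / 2))\<^sup>2"
  proof -
    have "\<bar>y / 2\<bar> \<le> sinh \<bar>y / 2\<bar>"
    proof -
      have "z \<le> sinh z" if "z \<ge> 0" for z :: real
      proof -
        have "sinh 0 - 0 \<le> sinh z - z"
          by (rule DERIV_nonneg_imp_nondecreasing[OF that])
            (auto intro!: derivative_eq_intros exI simp: cosh_real_ge_1)
        then show ?thesis by simp
      qed
      from this[of "\<bar>y / 2\<bar>"] show ?thesis by simp
    qed
    then have "\<bar>y / 2\<bar>\<^sup>2 \<le> (sinh \<bar>y / 2\<bar>)\<^sup>2" by (intro power_mono) auto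
    then show ?thesis by (cases "y \<ge> 0") (auto simp: abs_if)
  qed
  ultimately show ?thesis by (simp add: power_divide)
qed

text \<open>Completing the square turns the integrand into a constant times the normal density with
  mean \<open>\<theta> / (1 - d)\<close> and variance \<open>1 / (1 - d)\<close>, which is positive
  because \<open>d < 1\<close>.\<close>

lemma nn_integral_std_normal_exp:
  fixes d \<theta> :: real
  assumes "d < 1"
  shows "(\<integral>\<^sup>+ g. ennreal (exp (\<theta> * g + d * g\<^sup>2 / 2)) \<partial>std_normal_distribution) =
    ennreal (exp (\<theta>\<^sup>2 / (2 * (1 - d))) / sqrt (1 - d))" (is "_ = ennreal ?C")
proof -
  have "std_normal_density g * exp (\<theta> * g + d * g\<^sup>2 / 2) =
      ?C * normal_density (\<theta> / (1 - d)) (1 / sqrt (1 - d)) g" for g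
  proof -
    have e: "- g\<^sup>2 / 2 + (\<theta> * g + d * g\<^sup>2 / 2) =
        \<theta>\<^sup>2 / (2 * (1 - d)) - (1 - d) * (g - \<theta> / (1 - d))\<^sup>2 / 2"
    proof -
      define u where "u = \<theta> / (1 - d)"
      have thg: "\<theta> * g = (1 - d) * u * g" using assms by (simp add: u_def)
      have sq: "\<theta>\<^sup>2 / (2 * (1 - d)) = (1 - d) * u\<^sup>2 / 2"
        using assms by (simp add: u_def power2_eq_square divide_simps)
      show ?thesis
        unfolding sq thg u_def[symmetric] by (simp add: power2_eq_square field_simps)
    qed
    have "std_normal_density g * exp (\<theta> * g + d * g\<^sup>2 / 2) =
        1 / sqrt (2 * pi) * exp (- g\<^sup>2 / 2 + (\<theta> * g + d * g\<^sup>2 / 2))"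
      unfolding std_normal_density_def exp_add by simp
    also have "\<dots> = 1 / sqrt (2 * pi) * (exp (\<theta>\<^sup>2 / (2 * (1 - d))) *
        exp (- ((1 - d) * (g - \<theta> / (1 - d))\<^sup>2 / 2)))"
      unfolding e by (simp flip: exp_add)
    also have "\<dots> = ?C * normal_density (\<theta> / (1 - d)) (1 / sqrt (1 - d)) g"
      using assms unfolding normal_density_def
      by (simp add: power_divide real_sqrt_divide real_sqrt_mult mult.commute)
    finally show ?thesis .
  qed
  then have "(\<integral>\<^sup>+ g. ennreal (exp (\<theta> * g + d * g\<^sup>2 / 2)) \<partial>std_normal_distribution) =
      (\<integral>\<^sup>+ g. ennreal ?C * ennreal (normal_density (\<theta> / (1 - d)) (1 / sqrt (1 - d)) g) \<partial>lborel)"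
    using assms by (subst nn_integral_density)
      (auto simp flip: ennreal_mult' ennreal_mult simp: normal_density_nonneg)
  also have "\<dots> = ennreal ?C *
      (\<integral>\<^sup>+ g. ennreal (normal_density (\<theta> / (1 - d)) (1 / sqrt (1 - d)) g) \<partial>lborel)"
    by (rule nn_integral_cmult) auto
  also have "\<dots> = ennreal ?C"
    using assms by (subst nn_integral_eq_integral) (auto simp: normal_density_nonneg)
  finally show ?thesis .
qed

abbreviation std_normal_product :: "'b set \<Rightarrow> ('b \<Rightarrow> real) measure" where
  "std_normal_product V \<equiv> PiM V (\<lambda>_. std_normal_distribution)"

text \<open>The integrand factorizes over coordinates. With \<open>d = 0\<close> this linearizes
  squares; with positive \<open>d\<close> it evaluates the Gaussian integrals left after
  \<open>cosh\<close> has been estimated.\<close>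

lemma nn_integral_std_normal_product_exp:
  fixes d :: real and \<theta> :: "'b \<Rightarrow> real"
  assumes V: "finite V" and d: "d < 1"
  shows "(\<integral>\<^sup>+ g. ennreal (exp ((\<Sum>\<nu>\<in>V. \<theta> \<nu> * g \<nu>) + d * (\<Sum>\<nu>\<in>V. (g \<nu>)\<^sup>2) / 2))
      \<partial>std_normal_product V) =
    ennreal (exp ((\<Sum>\<nu>\<in>V. (\<theta> \<nu>)\<^sup>2) / (2 * (1 - d))) / sqrt (1 - d) ^ card V)"
proof -
  interpret prob_space std_normal_distribution
    by (rule prob_space_normal_density) simp
  interpret product_sigma_finite "\<lambda>_. std_normal_distribution"
    by unfold_locales
  have "(\<integral>\<^sup>+ g. ennreal (exp ((\<Sum>\<nu>\<in>V. \<theta> \<nu> * g \<nu>) + d * (\<Sum>\<nu>\<in>V. (g \<nu>)\<^sup>2) / 2))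
      \<partial>std_normal_product V) =
    (\<integral>\<^sup>+ g. (\<Prod>\<nu>\<in>V. ennreal (exp (\<theta> \<nu> * g \<nu> + d * (g \<nu>)\<^sup>2 / 2))) \<partial>std_normal_product V)"
    using V by (simp add: prod_ennreal exp_sum sum.distrib sum_distrib_left sum_divide_distrib flip: exp_sum)
  also have "\<dots> = (\<Prod>\<nu>\<in>V. ennreal (exp ((\<theta> \<nu>)\<^sup>2 / (2 * (1 - d))) / sqrt (1 - d)))"
    using V d by (subst product_nn_integral_prod) (auto simp: nn_integral_std_normal_exp)
  also have "\<dots> = ennreal (exp ((\<Sum>\<nu>\<in>V. (\<theta> \<nu>)\<^sup>2) / (2 * (1 - d))) / sqrt (1 - d) ^ card V)"
    using V d by (simp add: prod_ennreal prod_dividef exp_sum sum_divide_distrib)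
  finally show ?thesis .
qed

subsection \<open>Spin sums of Gaussian type\<close>

text \<open>Arbitrary index sets allow the spins to be split into the blocks \<open>{1..k}\<close>
  and \<open>{k+1..N}\<close>.\<close>

abbreviation spins :: "'i set \<Rightarrow> ('i \<Rightarrow> real) set" where
  "spins I \<equiv> PiE I (\<lambda>_. {-1, 1})"

definition spin_sum :: "'i set \<Rightarrow> ('i \<Rightarrow> 'b \<Rightarrow> real) \<Rightarrow> ('i \<Rightarrow> real) \<Rightarrow> 'b \<Rightarrow> real" where
  "spin_sum I x \<sigma> \<nu> = (\<Sum>i\<in>I. \<sigma> i * x i \<nu>)"

lemma sum_spins_exp:
  assumes "finite I"
  shows "(\<Sum>\<sigma>\<in>spins I. exp (\<Sum>i\<in>I. \<sigma> i * h i)) = 2 ^ card I * (\<Prod>i\<in>I. cosh (h i))"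
proof -
  have "(\<Sum>\<sigma>\<in>spins I. exp (\<Sum>i\<in>I. \<sigma> i * h i)) = (\<Prod>i\<in>I. \<Sum>s\<in>{-1, 1}. exp (s * h i))"
    unfolding exp_sum[OF assms] using assms by (subst prod_sum_PiE) auto
  also have "\<dots> = (\<Prod>i\<in>I. 2 * cosh (h i))"
    by (intro prod.cong) (simp_all add: cosh_field_def)
  finally show ?thesis by (simp add: prod.distrib)
qed

lemma card_spins: "finite I \<Longrightarrow> card (spins I) = 2 ^ card I"
  by (simp add: card_PiE numeral_2_eq_2)

lemma sum_spins_Un:
  assumes "finite A" "finite B" "A \<inter> B = {}"
  shows "(\<Sum>\<sigma>\<in>spins (A \<union> B). F (restrict \<sigma> A) (restrict \<sigma> B)) =
    (\<Sum>a\<in>spins A. \<Sum>b\<in>spins B. F a b)"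
proof -
  have "(\<Sum>\<sigma>\<in>spins (A \<union> B). F (restrict \<sigma> A) (restrict \<sigma> B)) =
      (\<Sum>(a, b)\<in>spins A \<times> spins B. F a b)"
    by (rule sum.reindex_bij_witness[where
          i = "\<lambda>(a, b). \<lambda>i\<in>A \<union> B. if i \<in> A then a i else b i" and
          j = "\<lambda>\<sigma>. (restrict \<sigma> A, restrict \<sigma> B)"])
      (use assms(3) in \<open>auto simp: PiE_iff fun_eq_iff extensional_def restrict_def split: if_splits\<close>)
  then show ?thesis by (simp add: sum.cartesian_product)
qed

text \<open>This is the Hubbard-Stratonovich transformation: once the square is linearized, the
  spins decouple and can be summed one at a time. The shift \<open>v\<close> is the contribution of
  spins held fixed.\<close>

lemma sum_spins_exp_square_eq_gaussian:
  fixes V :: "'b set" and v :: "'b \<Rightarrow> real"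
  assumes I: "finite I" and V: "finite V" and c: "0 \<le> c"
  shows "ennreal (\<Sum>\<sigma>\<in>spins I. exp (c / 2 * (\<Sum>\<nu>\<in>V. (v \<nu> + spin_sum I x \<sigma> \<nu>)\<^sup>2))) =
    (\<integral>\<^sup>+ g. ennreal (2 ^ card I * (exp (\<Sum>\<nu>\<in>V. sqrt c * v \<nu> * g \<nu>) *
      (\<Prod>i\<in>I. cosh (sqrt c * (\<Sum>\<nu>\<in>V. g \<nu> * x i \<nu>))))) \<partial>std_normal_product V)"
proof -
  let ?u = "\<lambda>\<sigma> \<nu>. v \<nu> + spin_sum I x \<sigma> \<nu>"
  have lin: "ennreal (exp (c / 2 * (\<Sum>\<nu>\<in>V. (u \<nu>)\<^sup>2))) =
      (\<integral>\<^sup>+ g. ennreal (exp (\<Sum>\<nu>\<in>V. sqrt c * u \<nu> * g \<nu>)) \<partial>std_normal_product V)" for u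
    using nn_integral_std_normal_product_exp[OF V, of 0 "\<lambda>\<nu>. sqrt c * u \<nu>"] c
    by (simp add: power_mult_distrib flip: sum_distrib_left)
  have pointwise: "(\<Sum>\<sigma>\<in>spins I. exp (\<Sum>\<nu>\<in>V. sqrt c * ?u \<sigma> \<nu> * g \<nu>)) =
      2 ^ card I * (exp (\<Sum>\<nu>\<in>V. sqrt c * v \<nu> * g \<nu>) *
      (\<Prod>i\<in>I. cosh (sqrt c * (\<Sum>\<nu>\<in>V. g \<nu> * x i \<nu>))))" for g
  proof -
    \<comment> \<open>Regrouping by sites: the spin at \<open>i\<close> feels the field
      \<open>sqrt c\<close> times the inner product of \<open>g\<close> and
      \<open>x i\<close>.\<close>
    have "(\<Sum>\<nu>\<in>V. sqrt c * ?u \<sigma> \<nu> * g \<nu>) = (\<Sum>\<nu>\<in>V. sqrt c * v \<nu> * g \<nu>) +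
        (\<Sum>i\<in>I. \<sigma> i * (sqrt c * (\<Sum>\<nu>\<in>V. g \<nu> * x i \<nu>)))" for \<sigma>
    proof -
      have "(\<Sum>\<nu>\<in>V. sqrt c * ?u \<sigma> \<nu> * g \<nu>) = (\<Sum>\<nu>\<in>V. sqrt c * v \<nu> * g \<nu>) +
          (\<Sum>\<nu>\<in>V. \<Sum>i\<in>I. \<sigma> i * (sqrt c * (g \<nu> * x i \<nu>)))"
        by (simp add: spin_sum_def algebra_simps sum.distrib sum_distrib_left sum_distrib_right)
      also have "(\<Sum>\<nu>\<in>V. \<Sum>i\<in>I. \<sigma> i * (sqrt c * (g \<nu> * x i \<nu>))) =
          (\<Sum>i\<in>I. \<sigma> i * (sqrt c * (\<Sum>\<nu>\<in>V. g \<nu> * x i \<nu>)))"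
        by (subst sum.swap) (simp add: sum_distrib_left)
      finally show ?thesis .
    qed
    then show ?thesis
      using sum_spins_exp[OF I, of "\<lambda>i. sqrt c * (\<Sum>\<nu>\<in>V. g \<nu> * x i \<nu>)"]
      by (simp add: exp_add mult_ac flip: sum_distrib_left)
  qed
  have "ennreal (\<Sum>\<sigma>\<in>spins I. exp (c / 2 * (\<Sum>\<nu>\<in>V. (?u \<sigma> \<nu>)\<^sup>2))) =
      (\<Sum>\<sigma>\<in>spins I. ennreal (exp (c / 2 * (\<Sum>\<nu>\<in>V. (?u \<sigma> \<nu>)\<^sup>2))))"
    by (simp add: sum_ennreal)
  also have "\<dots> = (\<Sum>\<sigma>\<in>spins I.
      \<integral>\<^sup>+ g. ennreal (exp (\<Sum>\<nu>\<in>V. sqrt c * ?u \<sigma> \<nu> * g \<nu>)) \<partial>std_normal_product V)"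
    by (simp only: lin)
  also have "\<dots> = (\<integral>\<^sup>+ g. (\<Sum>\<sigma>\<in>spins I. ennreal (exp (\<Sum>\<nu>\<in>V. sqrt c * ?u \<sigma> \<nu> * g \<nu>)))
      \<partial>std_normal_product V)"
    using V by (intro nn_integral_sum[symmetric]) measurable
  also have "\<dots> = (\<integral>\<^sup>+ g. ennreal (\<Sum>\<sigma>\<in>spins I. exp (\<Sum>\<nu>\<in>V. sqrt c * ?u \<sigma> \<nu> * g \<nu>))
      \<partial>std_normal_product V)"
    by (simp add: sum_ennreal)
  finally show ?thesis by (simp only: pointwise)
qed

text \<open>After linearization each \<open>cosh\<close> is at most the exponential of half its
  squared argument, and \<open>K\<close> bounds the resulting quadratic form in \<open>g\<close>. A
  Gaussian integral with \<open>d = c * K\<close> remains. The new coefficient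
  \<open>c / (1 - c * K)\<close> of the shift allows a second application to another block of
  spins.\<close>

lemma sum_spins_exp_square_le:
  fixes V :: "'b set" and v :: "'b \<Rightarrow> real"
  assumes I: "finite I" and V: "finite V" and c: "0 \<le> c"
    and K: "\<And>g. (\<Sum>i\<in>I. (\<Sum>\<nu>\<in>V. g \<nu> * x i \<nu>)\<^sup>2) \<le> K * (\<Sum>\<nu>\<in>V. (g \<nu>)\<^sup>2)"
    and cK: "c * K < 1"
  shows "(\<Sum>\<sigma>\<in>spins I. exp (c / 2 * (\<Sum>\<nu>\<in>V. (v \<nu> + spin_sum I x \<sigma> \<nu>)\<^sup>2))) \<le>
    2 ^ card I / sqrt (1 - c * K) ^ card V * exp (c / (1 - c * K) / 2 * (\<Sum>\<nu>\<in>V. (v \<nu>)\<^sup>2))"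
proof -
  have sq: "(sqrt c * y)\<^sup>2 = c * y\<^sup>2" for y
    using c by (simp add: power_mult_distrib)
  let ?s = "(\<Sum>\<sigma>\<in>spins I. exp (c / 2 * (\<Sum>\<nu>\<in>V. (v \<nu> + spin_sum I x \<sigma> \<nu>)\<^sup>2)))"
  have le: "exp (\<Sum>\<nu>\<in>V. sqrt c * v \<nu> * g \<nu>) * (\<Prod>i\<in>I. cosh (sqrt c * (\<Sum>\<nu>\<in>V. g \<nu> * x i \<nu>)))
      \<le> exp ((\<Sum>\<nu>\<in>V. sqrt c * v \<nu> * g \<nu>) + (c * K) * (\<Sum>\<nu>\<in>V. (g \<nu>)\<^sup>2) / 2)" for g
  proof -
    have "(\<Prod>i\<in>I. cosh (sqrt c * (\<Sum>\<nu>\<in>V. g \<nu> * x i \<nu>)))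
        \<le> (\<Prod>i\<in>I. exp ((sqrt c * (\<Sum>\<nu>\<in>V. g \<nu> * x i \<nu>))\<^sup>2 / 2))"
      by (intro prod_mono conjI cosh_le_exp_half_square) (simp add: cosh_real_nonneg)
    also have "\<dots> = exp (c * (\<Sum>i\<in>I. (\<Sum>\<nu>\<in>V. g \<nu> * x i \<nu>)\<^sup>2) / 2)"
      unfolding sq using I by (simp add: exp_sum sum_distrib_left sum_divide_distrib)
    also have "\<dots> \<le> exp ((c * K) * (\<Sum>\<nu>\<in>V. (g \<nu>)\<^sup>2) / 2)"
      using mult_left_mono[OF K[of g] c] by (simp add: mult_ac)
    finally show ?thesis by (simp add: exp_add)
  qed
  have "ennreal ?s \<le> (\<integral>\<^sup>+ g. ennreal (2 ^ card I) *
      ennreal (exp ((\<Sum>\<nu>\<in>V. sqrt c * v \<nu> * g \<nu>) + (c * K) * (\<Sum>\<nu>\<in>V. (g \<nu>)\<^sup>2) / 2))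
      \<partial>std_normal_product V)"
    unfolding sum_spins_exp_square_eq_gaussian[OF I V c]
    by (intro nn_integral_mono)
      (auto simp flip: ennreal_mult' intro!: ennreal_leI mult_left_mono le)
  also have "\<dots> = ennreal (2 ^ card I) *
      ennreal (exp ((\<Sum>\<nu>\<in>V. (sqrt c * v \<nu>)\<^sup>2) / (2 * (1 - c * K))) / sqrt (1 - c * K) ^ card V)"
    using V by (subst nn_integral_cmult)
      (measurable, simp add: nn_integral_std_normal_product_exp[OF V cK])
  also have "\<dots> = ennreal (2 ^ card I / sqrt (1 - c * K) ^ card V *
      exp (c / (1 - c * K) / 2 * (\<Sum>\<nu>\<in>V. (v \<nu>)\<^sup>2)))"
    using c cK by (simp add: power_mult_distrib mult_ac flip: ennreal_mult' sum_distrib_left)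
  finally show ?thesis
    using cK by (subst (asm) ennreal_le_iff) auto
qed

text \<open>The lower bound on \<open>cosh\<close> is available only for small arguments, so
  \<open>g\<close> is cut off at squared norm \<open>R * card V\<close>. The part beyond the cutoff
  is controlled by an exponential tilt \<open>s\<close>, and the condition on \<open>R\<close> keeps
  it below half of the full Gaussian integral.\<close>

lemma sum_spins_exp_square_ge:
  fixes V :: "'b set" and x :: "'i \<Rightarrow> 'b \<Rightarrow> real"
  assumes I: "finite I" and V: "finite V" "V \<noteq> {}" and c: "0 \<le> c" and \<eta>: "\<eta> \<le> 1"
    and K: "\<And>g. K * (\<Sum>\<nu>\<in>V. (g \<nu>)\<^sup>2) \<le> (\<Sum>i\<in>I. (\<Sum>\<nu>\<in>V. g \<nu> * x i \<nu>)\<^sup>2)"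
    and x: "\<And>i \<nu>. i \<in> I \<Longrightarrow> \<nu> \<in> V \<Longrightarrow> (x i \<nu>)\<^sup>2 = 1"
    and cosh: "\<And>y. y\<^sup>2 \<le> \<tau> \<Longrightarrow> exp ((1 - \<eta>) * (y\<^sup>2 / 2)) \<le> cosh y"
    and \<tau>: "c * R * (real (card V))\<^sup>2 \<le> \<tau>"
    and b: "b = c * (1 - \<eta>) * K" and s: "0 \<le> s" "b + s < 1"
    and R: "2 * sqrt (1 - b) * exp (- s * R / 2) \<le> sqrt (1 - b - s)"
  shows "2 ^ card I / (2 * sqrt (1 - b) ^ card V) \<le>
    (\<Sum>\<sigma>\<in>spins I. exp (c / 2 * (\<Sum>\<nu>\<in>V. (spin_sum I x \<sigma> \<nu>)\<^sup>2)))"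
proof -
  have sq: "(sqrt c * y)\<^sup>2 = c * y\<^sup>2" for y
    using c by (simp add: power_mult_distrib)
  let ?Z = "\<Sum>\<sigma>\<in>spins I. exp (c / 2 * (\<Sum>\<nu>\<in>V. (spin_sum I x \<sigma> \<nu>)\<^sup>2))"
  let ?M = "card V"
  let ?C = "\<lambda>g. \<Prod>i\<in>I. cosh (sqrt c * (\<Sum>\<nu>\<in>V. g \<nu> * x i \<nu>))"
  let ?e = "exp (- s * R * ?M / 2)"
  let ?n = "\<lambda>g. \<Sum>\<nu>\<in>V. (g \<nu>)\<^sup>2"
  have C_nonneg: "?C g \<ge> 0" for g by (intro prod_nonneg) (simp add: cosh_real_nonneg)
  \<comment> \<open>One inequality covers both regions: the first summand suffices inside the ball,
    the second outside.\<close>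
  have pointwise: "exp (b * ?n g / 2) \<le> ?C g + ?e * exp ((b + s) * ?n g / 2)" for g
  proof (cases "?n g \<le> R * ?M")
    case True
    have small: "(sqrt c * (\<Sum>\<nu>\<in>V. g \<nu> * x i \<nu>))\<^sup>2 \<le> \<tau>" if "i \<in> I" for i
    proof -
      \<comment> \<open>A pattern has squared norm \<open>card V\<close>, so Cauchy-Schwarz costs
        one factor \<open>card V\<close> and the cutoff another; this is why the square of
        \<open>card V\<close> enters the condition on \<open>\<tau>\<close>.\<close>
      have "(\<Sum>\<nu>\<in>V. g \<nu> * x i \<nu>)\<^sup>2 \<le> ?n g * (\<Sum>\<nu>\<in>V. (x i \<nu>)\<^sup>2)"
        by (rule Cauchy_Schwarz_ineq_sum)
      also have "(\<Sum>\<nu>\<in>V. (x i \<nu>)\<^sup>2) = ?M" using x that by simp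
      also have "?n g * ?M \<le> (R * ?M) * ?M" using True by (intro mult_right_mono) auto
      finally have "c * (\<Sum>\<nu>\<in>V. g \<nu> * x i \<nu>)\<^sup>2 \<le> c * ((R * ?M) * ?M)"
        using c by (rule mult_left_mono)
      with \<tau> show ?thesis unfolding sq by (simp add: power2_eq_square mult_ac)
    qed
    have "b * ?n g / 2 = (c * (1 - \<eta>)) * (K * ?n g) / 2"
      unfolding b by simp
    also have "\<dots> \<le> (c * (1 - \<eta>)) * (\<Sum>i\<in>I. (\<Sum>\<nu>\<in>V. g \<nu> * x i \<nu>)\<^sup>2) / 2"
      using c \<eta> by (intro divide_right_mono mult_left_mono K) auto
    also have "\<dots> = (\<Sum>i\<in>I. (1 - \<eta>) * ((sqrt c * (\<Sum>\<nu>\<in>V. g \<nu> * x i \<nu>))\<^sup>2 / 2))"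
      unfolding sq by (simp add: sum_distrib_left sum_divide_distrib mult_ac)
    finally have "exp (b * ?n g / 2)
        \<le> exp (\<Sum>i\<in>I. (1 - \<eta>) * ((sqrt c * (\<Sum>\<nu>\<in>V. g \<nu> * x i \<nu>))\<^sup>2 / 2))"
      by simp
    also have "\<dots> \<le> ?C g"
      unfolding exp_sum[OF I] by (intro prod_mono conjI cosh small) auto
    finally show ?thesis by (simp add: add_increasing2)
  next
    case False
    \<comment> \<open>Outside the ball the tilt \<open>s * (?n g - R * ?M) / 2\<close> is
      nonnegative.\<close>
    then have "b * ?n g / 2 \<le> - s * R * ?M / 2 + (b + s) * ?n g / 2"
      using mult_left_mono[of "R * ?M" "?n g" s] s by (simp add: field_simps)
    then have "exp (b * ?n g / 2) \<le> ?e * exp ((b + s) * ?n g / 2)"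
      by (simp flip: exp_add)
    then show ?thesis using C_nonneg[of g] by linarith
  qed
  have gauss: "(\<integral>\<^sup>+ g. ennreal (exp (d * ?n g / 2)) \<partial>std_normal_product V) =
      ennreal (1 / sqrt (1 - d) ^ ?M)" if "d < 1" for d
    using nn_integral_std_normal_product_exp[OF V(1) that, of "\<lambda>_. 0"] by simp
  have "ennreal (2 ^ card I * (1 / sqrt (1 - b) ^ ?M)) =
      (\<integral>\<^sup>+ g. ennreal (2 ^ card I) * ennreal (exp (b * ?n g / 2)) \<partial>std_normal_product V)"
    using s V by (subst nn_integral_cmult) (measurable, simp add: gauss flip: ennreal_mult')
  also have "\<dots> \<le> (\<integral>\<^sup>+ g. ennreal (2 ^ card I * ?C g) +
      ennreal (2 ^ card I * ?e) * ennreal (exp ((b + s) * ?n g / 2)) \<partial>std_normal_product V)"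
  proof (intro nn_integral_mono)
    fix g
    have "2 ^ card I * exp (b * ?n g / 2) \<le>
        2 ^ card I * ?C g + 2 ^ card I * ?e * exp ((b + s) * ?n g / 2)"
      using mult_left_mono[OF pointwise[of g], of "2 ^ card I"] by (simp add: algebra_simps)
    then show "ennreal (2 ^ card I) * ennreal (exp (b * ?n g / 2)) \<le> ennreal (2 ^ card I * ?C g) +
      ennreal (2 ^ card I * ?e) * ennreal (exp ((b + s) * ?n g / 2))"
      using C_nonneg[of g] by (simp flip: ennreal_mult' ennreal_plus add: ennreal_leI)
  qed
  also have "\<dots> = (\<integral>\<^sup>+ g. ennreal (2 ^ card I * ?C g) \<partial>std_normal_product V) +
      ennreal (2 ^ card I * ?e) * ennreal (1 / sqrt (1 - (b + s)) ^ ?M)"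
  proof -
    have meas: "(\<lambda>g. ennreal (2 ^ card I * ?C g)) \<in> borel_measurable (std_normal_product V)"
      unfolding cosh_field_def using I V(1) by measurable
    have "(\<lambda>g. ennreal (exp ((b + s) * ?n g / 2))) \<in> borel_measurable (std_normal_product V)"
      using V(1) by measurable
    then show ?thesis
      using meas s(2) by (simp add: nn_integral_add nn_integral_cmult gauss del: times_divide_eq_right)
  qed
  also have "(\<integral>\<^sup>+ g. ennreal (2 ^ card I * ?C g) \<partial>std_normal_product V) = ennreal ?Z"
    using sum_spins_exp_square_eq_gaussian[OF I V(1) c, of "\<lambda>_. 0" x] by simp
  also have "ennreal ?Z + ennreal (2 ^ card I * ?e) * ennreal (1 / sqrt (1 - (b + s)) ^ ?M) =
      ennreal (?Z + 2 ^ card I * (?e / sqrt (1 - (b + s)) ^ ?M))"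
    using s(2) by (simp add: sum_nonneg flip: ennreal_mult' ennreal_plus)
  finally have main: "2 ^ card I * (1 / sqrt (1 - b) ^ ?M) \<le>
      ?Z + 2 ^ card I * (?e / sqrt (1 - (b + s)) ^ ?M)"
    using s(2) by (subst (asm) ennreal_le_iff) (auto intro!: add_nonneg_nonneg sum_nonneg)
  \<comment> \<open>By the choice of \<open>R\<close>, each coordinate gains a factor 1/2 over the
    main term. Since \<open>V\<close> is nonempty, at least one such factor is present.\<close>
  have "?e / sqrt (1 - (b + s)) ^ ?M \<le> 1 / (2 * sqrt (1 - b) ^ ?M)"
  proof -
    have pos: "sqrt (1 - b - s) > 0" "sqrt (1 - b) > 0" using s by auto
    have "exp (- s * R / 2) / sqrt (1 - b - s) \<le> 1 / (2 * sqrt (1 - b))"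
      using R pos by (simp add: field_simps)
    then have "(exp (- s * R / 2) / sqrt (1 - b - s)) ^ ?M \<le> (1 / (2 * sqrt (1 - b))) ^ ?M"
      using pos by (intro power_mono) auto
    also have "\<dots> = 1 / (2 ^ ?M * sqrt (1 - b) ^ ?M)"
      by (simp add: power_divide power_mult_distrib)
    also have "\<dots> \<le> 1 / (2 * sqrt (1 - b) ^ ?M)"
    proof -
      have "(2::real) ^ 1 \<le> 2 ^ ?M"
        using V by (intro power_increasing) (auto simp: Suc_le_eq card_gt_0_iff)
      then show ?thesis
        using pos by (intro divide_left_mono mult_right_mono) (auto intro!: mult_pos_pos)
    qed
    finally show ?thesis
      by (simp add: power_divide algebra_simps flip: exp_of_nat_mult)
  qed
  from mult_left_mono[OF this, of "2 ^ card I"] main show ?thesis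
    by (simp add: field_simps)
qed

subsection \<open>Nearly isotropic patterns\<close>

definition pattern_correlation :: "'b set \<Rightarrow> 'i set \<Rightarrow> ('i \<Rightarrow> 'b \<Rightarrow> real) \<Rightarrow> real" where
  "pattern_correlation V I x =
    (\<Sum>p\<in>{p \<in> V \<times> V. fst p \<noteq> snd p}. (\<Sum>i\<in>I. x i (fst p) * x i (snd p))\<^sup>2)"

text \<open>For finite \<open>V\<close> and finite nonempty \<open>I\<close>, this says that the
  empirical covariance matrix of the patterns over \<open>I\<close> is within
  \<open>\<delta>\<close> of the identity in operator norm, expressed through quadratic
  forms.\<close>

definition nearly_isotropic ::
  "real \<Rightarrow> 'b set \<Rightarrow> 'i set \<Rightarrow> ('i \<Rightarrow> 'b \<Rightarrow> real) \<Rightarrow> bool" where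
  "nearly_isotropic \<delta> V I x \<longleftrightarrow> (\<forall>g.
    \<bar>(\<Sum>i\<in>I. (\<Sum>\<nu>\<in>V. g \<nu> * x i \<nu>)\<^sup>2) - real (card I) * (\<Sum>\<nu>\<in>V. (g \<nu>)\<^sup>2)\<bar>
      \<le> \<delta> * real (card I) * (\<Sum>\<nu>\<in>V. (g \<nu>)\<^sup>2))"

text \<open>
  For patterns with entries \<open>-1, 1\<close>, \<open>pattern_correlation\<close> is the squared Frobenius norm of the
  Gram matrix minus its diagonal \<open>card I\<close>.
\<close>

lemma nearly_isotropicI:
  fixes x :: "'i \<Rightarrow> 'b \<Rightarrow> real"
  assumes I: "finite I" and V: "finite V" and \<delta>: "0 \<le> \<delta>"
    and x: "\<And>i \<nu>. i \<in> I \<Longrightarrow> \<nu> \<in> V \<Longrightarrow> (x i \<nu>)\<^sup>2 = 1"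
    and corr: "pattern_correlation V I x \<le> (\<delta> * real (card I))\<^sup>2"
  shows "nearly_isotropic \<delta> V I x"
  unfolding nearly_isotropic_def
proof
  fix g :: "'b \<Rightarrow> real"
  let ?D = "{p \<in> V \<times> V. fst p = snd p}" and ?O = "{p \<in> V \<times> V. fst p \<noteq> snd p}"
  let ?a = "\<lambda>p. g (fst p) * g (snd p)" and ?G = "\<lambda>p. \<Sum>i\<in>I. x i (fst p) * x i (snd p)"
  let ?n = "\<Sum>\<nu>\<in>V. (g \<nu>)\<^sup>2"
  \<comment> \<open>The diagonal of the Gram matrix contributes exactly \<open>card I * ?n\<close>,
    so the deviation is the off-diagonal part alone.\<close>
  have "(\<Sum>i\<in>I. (\<Sum>\<nu>\<in>V. g \<nu> * x i \<nu>)\<^sup>2) = (\<Sum>i\<in>I. \<Sum>p\<in>V \<times> V. ?a p * (x i (fst p) * x i (snd p)))"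
    by (simp add: power2_eq_square sum_product sum.cartesian_product case_prod_beta mult_ac)
  also have "\<dots> = (\<Sum>p\<in>V \<times> V. ?a p * ?G p)"
    by (subst sum.swap) (simp add: sum_distrib_left)
  also have "\<dots> = (\<Sum>p\<in>?D. ?a p * ?G p) + (\<Sum>p\<in>?O. ?a p * ?G p)"
    using V by (subst sum.union_disjoint[symmetric]) (auto intro!: sum.cong)
  also have "(\<Sum>p\<in>?D. ?a p * ?G p) = (\<Sum>\<nu>\<in>V. g \<nu> * g \<nu> * (\<Sum>i\<in>I. x i \<nu> * x i \<nu>))"
    by (rule sum.reindex_bij_witness[where i = "\<lambda>\<nu>. (\<nu>, \<nu>)" and j = fst]) auto
  also have "\<dots> = real (card I) * ?n"
    using x by (simp add: sum_distrib_left mult.commute flip: power2_eq_square)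
  finally have diff: "(\<Sum>i\<in>I. (\<Sum>\<nu>\<in>V. g \<nu> * x i \<nu>)\<^sup>2) - real (card I) * ?n =
      (\<Sum>p\<in>?O. ?a p * ?G p)" by simp
  \<comment> \<open>Cauchy-Schwarz over pairs is the bound of the operator norm by the Frobenius
    norm.\<close>
  have "(\<Sum>p\<in>?O. ?a p * ?G p)\<^sup>2 \<le> (\<Sum>p\<in>?O. (?a p)\<^sup>2) * (\<Sum>p\<in>?O. (?G p)\<^sup>2)"
    by (rule Cauchy_Schwarz_ineq_sum)
  also have "\<dots> \<le> (\<Sum>p\<in>V \<times> V. (?a p)\<^sup>2) * (\<delta> * real (card I))\<^sup>2"
    using V corr unfolding pattern_correlation_def
    by (intro mult_mono sum_mono2 sum_nonneg) auto
  also have "(\<Sum>p\<in>V \<times> V. (?a p)\<^sup>2) = ?n\<^sup>2"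
    by (simp add: power2_eq_square sum_product sum.cartesian_product case_prod_beta mult_ac)
  finally have "(\<Sum>p\<in>?O. ?a p * ?G p)\<^sup>2 \<le> (\<delta> * real (card I) * ?n)\<^sup>2"
    by (simp add: power_mult_distrib mult_ac)
  then have "\<bar>\<Sum>p\<in>?O. ?a p * ?G p\<bar> \<le> \<delta> * real (card I) * ?n"
    using \<delta> by (intro abs_le_square_iff[THEN iffD2, THEN order_trans[OF _ eq_refl[OF abs_of_nonneg]]])
      (auto intro!: mult_nonneg_nonneg sum_nonneg)
  then show "\<bar>(\<Sum>i\<in>I. (\<Sum>\<nu>\<in>V. g \<nu> * x i \<nu>)\<^sup>2) - real (card I) * ?n\<bar> \<le> \<delta> * real (card I) * ?n"
    unfolding diff .
qed

lemma nearly_isotropicD: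
  assumes "nearly_isotropic \<delta> V I x"
  shows "(\<Sum>i\<in>I. (\<Sum>\<nu>\<in>V. g \<nu> * x i \<nu>)\<^sup>2) \<le> real (card I) * (1 + \<delta>) * (\<Sum>\<nu>\<in>V. (g \<nu>)\<^sup>2)"
    and "real (card I) * (1 - \<delta>) * (\<Sum>\<nu>\<in>V. (g \<nu>)\<^sup>2) \<le> (\<Sum>i\<in>I. (\<Sum>\<nu>\<in>V. g \<nu> * x i \<nu>)\<^sup>2)"
  using assms[unfolded nearly_isotropic_def, rule_format, of g]
  by (auto simp: abs_le_iff algebra_simps)

section \<open>Total variation distance and the product measure\<close>

lemma bdd_above_tv: "bdd_above (range (\<lambda>A. \<bar>measure_pmf.prob p A - measure_pmf.prob q A\<bar>))"
proof (rule bdd_aboveI2)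
  fix A
  show "\<bar>measure_pmf.prob p A - measure_pmf.prob q A\<bar> \<le> 1"
    using measure_pmf.prob_le_1[of p A] measure_pmf.prob_le_1[of q A]
      measure_nonneg[of p A] measure_nonneg[of q A] by linarith
qed

lemma tv_dist_ge: "\<bar>measure_pmf.prob p A - measure_pmf.prob q A\<bar> \<le> tv_dist p q"
  unfolding tv_dist_def by (rule cSUP_upper[OF UNIV_I bdd_above_tv])

lemma tv_dist_le_1: "tv_dist p q \<le> 1"
  unfolding tv_dist_def
proof (rule cSUP_least)
  fix A
  show "\<bar>measure_pmf.prob p A - measure_pmf.prob q A\<bar> \<le> 1"
    using measure_pmf.prob_le_1[of p A] measure_pmf.prob_le_1[of q A]
      measure_nonneg[of p A] measure_nonneg[of q A] by linarith
qed simp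

lemma rademacher_product_eq: "rademacher_product k = pmf_of_set (spins {1..k})"
proof -
  have "PiE_dflt {1..k} undefined (\<lambda>_. {-1, 1::real}) = spins {1..k}"
    unfolding PiE_dflt_def PiE_def Pi_def extensional_def by blast
  then show ?thesis
    unfolding rademacher_product_def rademacher_def by (subst Pi_pmf_of_set) auto
qed

lemma prob_rademacher_product:
  "measure_pmf.prob (rademacher_product k) A = real (card (spins {1..k} \<inter> A)) / 2 ^ k"
  unfolding rademacher_product_eq
  by (subst measure_pmf_of_set) (auto simp: PiE_eq_empty_iff finite_PiE card_spins)

text \<open>Chernoff bound: the indicator is dominated by an exponential with coefficient
  \<open>s / k\<close>, and the upper bound on spin sums applies with
  \<open>K = k * (1 + \<delta>)\<close>, so that \<open>c * K = s * (1 + \<delta>)\<close>.\<close>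

lemma prob_rademacher_large_spin_sum:
  fixes V :: "nat set"
  assumes k: "0 < k" and V: "finite V" and iso: "nearly_isotropic \<delta> V {1..k} x"
    and s: "0 \<le> s" "s * (1 + \<delta>) < 1"
  shows "measure_pmf.prob (rademacher_product k)
      {\<tau>. t * real k * real (card V) < (\<Sum>\<nu>\<in>V. (spin_sum {1..k} x \<tau> \<nu>)\<^sup>2)}
    \<le> (exp (- s * t / 2) / sqrt (1 - s * (1 + \<delta>))) ^ card V"
proof -
  let ?T = "\<lambda>\<tau>. \<Sum>\<nu>\<in>V. (spin_sum {1..k} x \<tau> \<nu>)\<^sup>2"
  let ?A = "{\<tau>. t * real k * real (card V) < ?T \<tau>}"
  let ?S = "spins {1..k}"
  let ?c = "s / real k"
  have fin: "finite ?S" by (simp add: finite_PiE)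
  have "real (card (?S \<inter> ?A)) = (\<Sum>\<tau>\<in>?S \<inter> ?A. 1)" by simp
  also have "\<dots> \<le> (\<Sum>\<tau>\<in>?S \<inter> ?A. exp (- s * t / 2 * card V) * exp (?c / 2 * ?T \<tau>))"
  proof (intro sum_mono)
    fix \<tau> assume "\<tau> \<in> ?S \<inter> ?A"
    then have "?c / 2 * (t * real k * real (card V)) \<le> ?c / 2 * ?T \<tau>"
      using s by (intro mult_left_mono) auto
    then have "0 \<le> - s * t / 2 * card V + ?c / 2 * ?T \<tau>"
      using k by (simp add: field_simps)
    then show "1 \<le> exp (- s * t / 2 * card V) * exp (?c / 2 * ?T \<tau>)"
      by (simp flip: exp_add)
  qed
  also have "\<dots> \<le> (\<Sum>\<tau>\<in>?S. exp (- s * t / 2 * card V) * exp (?c / 2 * ?T \<tau>))"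
    using fin by (intro sum_mono2) auto
  also have "\<dots> = exp (- s * t / 2 * card V) * (\<Sum>\<tau>\<in>?S. exp (?c / 2 * ?T \<tau>))"
    by (simp add: sum_distrib_left)
  also have "\<dots> \<le> exp (- s * t / 2 * card V) * (2 ^ k / sqrt (1 - s * (1 + \<delta>)) ^ card V)"
    using sum_spins_exp_square_le[of "{1..k}" V ?c x "real k * (1 + \<delta>)" "\<lambda>_. 0"]
      k V s nearly_isotropicD(1)[OF iso] by (intro mult_left_mono) auto
  also have "exp (- s * t / 2 * card V) = exp (- s * t / 2) ^ card V"
    by (simp only: mult.commute[of "- s * t / 2" "real (card V)"] exp_of_nat_mult)
  finally have le: "real (card (?S \<inter> ?A)) \<le>
      exp (- s * t / 2) ^ card V * (2 ^ k / sqrt (1 - s * (1 + \<delta>)) ^ card V)" .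
  show ?thesis
    unfolding prob_rademacher_product power_divide
    by (rule order_trans[OF divide_right_mono[OF le]]) simp_all
qed

section \<open>Gibbs weights and the law of the first spins\<close>

lemma gibbs_weight_eq:
  "gibbs_weight \<beta> N M x \<sigma> =
    exp (\<beta> / real N / 2 * (\<Sum>\<nu>\<in>{1..M}. (spin_sum {1..N} x \<sigma> \<nu>)\<^sup>2))"
proof -
  have "(L2_set (overlap N x \<sigma>) {1..M})\<^sup>2 = (\<Sum>\<nu>\<in>{1..M}. (1 / real N * spin_sum {1..N} x \<sigma> \<nu>)\<^sup>2)"
    unfolding L2_set_def overlap_def spin_sum_def by (rule real_sqrt_pow2) (simp add: sum_nonneg)
  also have "\<dots> = (1 / real N)\<^sup>2 * (\<Sum>\<nu>\<in>{1..M}. (spin_sum {1..N} x \<sigma> \<nu>)\<^sup>2)"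
    unfolding power_mult_distrib sum_distrib_left ..
  finally have eq: "(L2_set (overlap N x \<sigma>) {1..M})\<^sup>2 =
      (1 / real N)\<^sup>2 * (\<Sum>\<nu>\<in>{1..M}. (spin_sum {1..N} x \<sigma> \<nu>)\<^sup>2)" .
  \<comment> \<open>For \<open>N = 0\<close> both sides vanish, by division by zero on the
    right.\<close>
  have "\<beta> * real N / 2 * ((1 / real N)\<^sup>2 * S) = \<beta> / real N / 2 * S" for S
    by (cases "N = 0") (simp_all add: power2_eq_square)
  then show ?thesis
    unfolding gibbs_weight_def eq by (rule arg_cong)
qed

lemma prob_gibbs_marginal:
  "measure_pmf.prob (gibbs_marginal \<beta> N M k x) B =
    (\<Sum>\<sigma>\<in>{\<sigma> \<in> spins {1..N}. restrict \<sigma> {1..k} \<in> B}. gibbs_weight \<beta> N M x \<sigma>) /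
    partition_function \<beta> N M x"
proof -
  let ?B = "(\<lambda>\<sigma>. restrict \<sigma> {1..k}) -` B"
  let ?p = "gibbs_measure \<beta> N M x"
  let ?C = "{\<sigma> \<in> spins {1..N}. restrict \<sigma> {1..k} \<in> B}"
  \<comment> \<open>The preimage of \<open>B\<close> need not be finite; passing to the support
    turns its probability into a finite sum.\<close>
  have "set_pmf ?p \<subseteq> spins {1..N}"
    by (rule subsetI, rule ccontr) (simp add: set_pmf_iff pmf_gibbs_measure spin_configs_def)
  then have "?B \<inter> set_pmf ?p = ?C \<inter> set_pmf ?p" by auto
  then have "measure_pmf.prob ?p ?B = measure_pmf.prob ?p ?C"
    using measure_Int_set_pmf[of ?p ?B] measure_Int_set_pmf[of ?p ?C] by (simp only:)
  also have "\<dots> = (\<Sum>\<sigma>\<in>?C. pmf ?p \<sigma>)"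
    by (intro measure_measure_pmf_finite) (simp add: finite_PiE)
  also have "\<dots> = (\<Sum>\<sigma>\<in>?C. gibbs_weight \<beta> N M x \<sigma> / partition_function \<beta> N M x)"
    by (intro sum.cong) (auto simp: pmf_gibbs_measure spin_configs_def)
  finally show ?thesis
    by (simp add: gibbs_marginal_def sum_divide_distrib)
qed

text \<open>
  The indicator is bounded by \<open>exp (\<theta> / 2 (t M - |S\<^sub>k|\<^sup>2 / k))\<close>.  Summing out the last \<open>N - k\<close> spins
  first produces a positive multiple of \<open>|S\<^sub>k|\<^sup>2\<close> that absorbs the negative term for small \<open>\<theta>\<close>,
  so that only nonnegative quadratic forms have to be linearized.
\<close>

lemma gibbs_weight_sum_small_spin_sum:
  fixes N k M :: nat
  assumes k: "0 < k" "k < N" and \<beta>: "0 < \<beta>" and \<theta>: "0 \<le> \<theta>"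
    and iso: "nearly_isotropic \<delta> {1..M} {1..k} x" "nearly_isotropic \<delta> {1..M} {k+1..N} x"
    and d: "d = \<beta> * (1 + \<delta>) * (1 - real k / real N)" "d < 1"
    and f: "f = (\<beta> * (real k / real N) / (1 - d) - \<theta>) * (1 + \<delta>)" "f < 1"
    and e: "\<theta> \<le> \<beta> * (real k / real N) / (1 - d)"
  shows "(\<Sum>\<sigma>\<in>{\<sigma> \<in> spins {1..N}. restrict \<sigma> {1..k} \<in>
        {\<tau>. (\<Sum>\<nu>\<in>{1..M}. (spin_sum {1..k} x \<tau> \<nu>)\<^sup>2) \<le> t * real k * real M}}. gibbs_weight \<beta> N M x \<sigma>)
    \<le> 2 ^ N * (exp (\<theta> * t / 2) / (sqrt (1 - d) * sqrt (1 - f))) ^ M"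
proof -
  let ?V = "{1..M}" and ?A = "{1..k}" and ?B = "{k+1..N}"
  let ?T = "\<lambda>\<tau>. \<Sum>\<nu>\<in>?V. (spin_sum ?A x \<tau> \<nu>)\<^sup>2"
  let ?C = "{\<sigma> \<in> spins {1..N}. restrict \<sigma> ?A \<in> {\<tau>. ?T \<tau> \<le> t * real k * real M}}"
  let ?c = "\<beta> / real N"
  let ?F = "\<lambda>a b. exp (- (\<theta> / real k / 2 * ?T a)) *
      exp (?c / 2 * (\<Sum>\<nu>\<in>?V. (spin_sum ?A x a \<nu> + spin_sum ?B x b \<nu>)\<^sup>2))"
  have AB: "{1..N} = ?A \<union> ?B" using k by auto
  have cK: "?c * (real (card ?B) * (1 + \<delta>)) = d"
    using k unfolding d(1) by (simp add: field_simps of_nat_diff)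
  have split: "spin_sum {1..N} x \<sigma> \<nu> =
      spin_sum ?A x (restrict \<sigma> ?A) \<nu> + spin_sum ?B x (restrict \<sigma> ?B) \<nu>" for \<sigma> \<nu>
    unfolding AB spin_sum_def by (subst sum.union_disjoint) auto
  have "(\<Sum>\<sigma>\<in>?C. gibbs_weight \<beta> N M x \<sigma>)
      \<le> (\<Sum>\<sigma>\<in>?C. exp (\<theta> * t / 2 * M) * ?F (restrict \<sigma> ?A) (restrict \<sigma> ?B))"
  proof (intro sum_mono)
    fix \<sigma> assume "\<sigma> \<in> ?C"
    then have "\<theta> / real k / 2 * ?T (restrict \<sigma> ?A) \<le> \<theta> / real k / 2 * (t * real k * real M)"
      using \<theta> by (intro mult_left_mono) auto
    then have "0 \<le> \<theta> * t / 2 * M + - (\<theta> / real k / 2 * ?T (restrict \<sigma> ?A))"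
      using k by (simp add: field_simps)
    then have "1 \<le> exp (\<theta> * t / 2 * M) * exp (- (\<theta> / real k / 2 * ?T (restrict \<sigma> ?A)))"
      by (simp flip: exp_add)
    from mult_right_mono[OF this, of "gibbs_weight \<beta> N M x \<sigma>"]
    show "gibbs_weight \<beta> N M x \<sigma>
        \<le> exp (\<theta> * t / 2 * M) * ?F (restrict \<sigma> ?A) (restrict \<sigma> ?B)"
      unfolding gibbs_weight_eq split by (simp add: mult.assoc)
  qed
  also have "\<dots> \<le> (\<Sum>\<sigma>\<in>spins {1..N}. exp (\<theta> * t / 2 * M) * ?F (restrict \<sigma> ?A) (restrict \<sigma> ?B))"
    by (intro sum_mono2) (auto simp: finite_PiE)
  also have "\<dots> = exp (\<theta> * t / 2 * M) *
      (\<Sum>\<sigma>\<in>spins (?A \<union> ?B). ?F (restrict \<sigma> ?A) (restrict \<sigma> ?B))"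
    unfolding AB[symmetric] by (rule sum_distrib_left[symmetric])
  also have "(\<Sum>\<sigma>\<in>spins (?A \<union> ?B). ?F (restrict \<sigma> ?A) (restrict \<sigma> ?B)) =
      (\<Sum>a\<in>spins ?A. \<Sum>b\<in>spins ?B. ?F a b)"
    by (rule sum_spins_Un) auto
  also have "\<dots> \<le> (\<Sum>a\<in>spins ?A. 2 ^ (N - k) / sqrt (1 - d) ^ M *
      exp ((?c / (1 - d) - \<theta> / real k) / 2 * ?T a))"
  proof (intro sum_mono)
    fix a
    \<comment> \<open>With the first block fixed at \<open>a\<close>, its spin sum acts as the shift
      while the last \<open>N - k\<close> spins are summed out.\<close>
    have "(\<Sum>b\<in>spins ?B. ?F a b) = exp (- (\<theta> / real k / 2 * ?T a)) *
      (\<Sum>b\<in>spins ?B. exp (?c / 2 * (\<Sum>\<nu>\<in>?V. (spin_sum ?A x a \<nu> + spin_sum ?B x b \<nu>)\<^sup>2)))"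
      by (simp add: sum_distrib_left)
    also have "\<dots> \<le> exp (- (\<theta> / real k / 2 * ?T a)) *
        (2 ^ card ?B / sqrt (1 - d) ^ card ?V * exp (?c / (1 - d) / 2 * ?T a))"
      using sum_spins_exp_square_le[of ?B ?V ?c x "real (card ?B) * (1 + \<delta>)" "spin_sum ?A x a"]
        \<beta> d(2) nearly_isotropicD(1)[OF iso(2)] unfolding cK by (intro mult_left_mono) auto
    also have "\<dots> = 2 ^ (N - k) / sqrt (1 - d) ^ M *
        (exp (- (\<theta> / real k / 2 * ?T a)) * exp (?c / (1 - d) / 2 * ?T a))"
      by simp
    also have "exp (- (\<theta> / real k / 2 * ?T a)) * exp (?c / (1 - d) / 2 * ?T a) =
        exp ((?c / (1 - d) - \<theta> / real k) / 2 * ?T a)"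
    proof -
      have "- (u / 2 * y) + w / 2 * y = (w - u) / 2 * y" for u w y :: real
        by (simp add: field_simps)
      then show ?thesis by (simp only: exp_add[symmetric])
    qed
    finally show "(\<Sum>b\<in>spins ?B. ?F a b) \<le> 2 ^ (N - k) / sqrt (1 - d) ^ M *
        exp ((?c / (1 - d) - \<theta> / real k) / 2 * ?T a)" .
  qed
  also have "\<dots> = 2 ^ (N - k) / sqrt (1 - d) ^ M *
      (\<Sum>a\<in>spins ?A. exp ((?c / (1 - d) - \<theta> / real k) / 2 * ?T a))"
    by (rule sum_distrib_left[symmetric])
  also have "\<dots> \<le> 2 ^ (N - k) / sqrt (1 - d) ^ M * (2 ^ k / sqrt (1 - f) ^ M)"
  proof -
    \<comment> \<open>Assumption \<open>e\<close> enters here: the remaining coefficient must be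
      nonnegative to admit a Gaussian linearization over the first block.\<close>
    have nonneg: "0 \<le> ?c / (1 - d) - \<theta> / real k"
      using e k d(2) by (simp add: field_simps)
    have cK': "(?c / (1 - d) - \<theta> / real k) * (real k * (1 + \<delta>)) = f"
    proof -
      have "(?c / (1 - d) - \<theta> / real k) * real k = \<beta> * (real k / real N) / (1 - d) - \<theta>"
        using k by (simp add: left_diff_distrib)
      then show ?thesis unfolding f(1) mult.assoc[symmetric] by (simp only:)
    qed
    show ?thesis
      using sum_spins_exp_square_le[of ?A ?V "?c / (1 - d) - \<theta> / real k" x "real k * (1 + \<delta>)" "\<lambda>_. 0"]
        f(2) d(2) nearly_isotropicD(1)[OF iso(1)] nonneg unfolding cK' by (intro mult_left_mono) auto
  qed
  also have "exp (\<theta> * t / 2 * M) *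
      (2 ^ (N - k) / sqrt (1 - d) ^ M * (2 ^ k / sqrt (1 - f) ^ M)) =
      (2 ^ (N - k) * 2 ^ k) * (exp (\<theta> * t / 2) / (sqrt (1 - d) * sqrt (1 - f))) ^ M"
    by (simp add: power_divide power_mult_distrib mult_ac flip: exp_of_nat_mult)
  also have "(2::real) ^ (N - k) * 2 ^ k = 2 ^ N"
    using k by (simp flip: power_add)
  finally show ?thesis by (simp_all only: mult_left_mono exp_ge_zero)
qed

text \<open>The test event is that the squared spin sum exceeds \<open>t * k * M\<close>. The
  product measure gives it small probability by the Chernoff bound. Its complement has small Gibbs
  probability: the restricted sum of weights is divided by the lower bound on the partition
  function, which is the source of the factors 2 and \<open>sqrt (1 - b)\<close>.\<close>

lemma tv_dist_gibbs_marginal_ge: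
  fixes N k M :: nat
  assumes k: "0 < k" "k < N" and M: "0 < M" and \<beta>: "0 < \<beta>" and \<delta>: "\<delta> \<le> 1"
    and x: "\<And>i \<nu>. i \<in> {1..N} \<Longrightarrow> \<nu> \<in> {1..M} \<Longrightarrow> (x i \<nu>)\<^sup>2 = 1"
    and iso: "nearly_isotropic \<delta> {1..M} {1..k} x" "nearly_isotropic \<delta> {1..M} {k+1..N} x"
      "nearly_isotropic \<delta> {1..M} {1..N} x"
    and \<theta>: "0 \<le> \<theta>"
    and d: "d = \<beta> * (1 + \<delta>) * (1 - real k / real N)" "d < 1"
    and f: "f = (\<beta> * (real k / real N) / (1 - d) - \<theta>) * (1 + \<delta>)" "f < 1"
    and e: "\<theta> \<le> \<beta> * (real k / real N) / (1 - d)"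
    and cosh: "\<And>y. y\<^sup>2 \<le> \<tau> \<Longrightarrow> exp ((1 - \<delta>) * (y\<^sup>2 / 2)) \<le> cosh y"
    and \<tau>: "\<beta> / real N * R * (real M)\<^sup>2 \<le> \<tau>"
    and b: "b = \<beta> * (1 - \<delta>)\<^sup>2" and r: "0 \<le> r" "b + r < 1"
    and R: "2 * sqrt (1 - b) * exp (- r * R / 2) \<le> sqrt (1 - b - r)"
    and s: "0 \<le> s" "s * (1 + \<delta>) < 1"
  shows "1 - 2 * (sqrt (1 - b) * exp (\<theta> * t / 2) / (sqrt (1 - d) * sqrt (1 - f))) ^ M
      - (exp (- s * t / 2) / sqrt (1 - s * (1 + \<delta>))) ^ M
    \<le> tv_dist (gibbs_marginal \<beta> N M k x) (rademacher_product k)"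
proof -
  let ?T = "\<lambda>\<tau>. \<Sum>\<nu>\<in>{1..M}. (spin_sum {1..k} x \<tau> \<nu>)\<^sup>2"
  let ?B = "{\<tau>. ?T \<tau> \<le> t * real k * real M}" and ?A = "{\<tau>. t * real k * real M < ?T \<tau>}"
  let ?p = "gibbs_marginal \<beta> N M k x" and ?q = "rademacher_product k"
  let ?z = "2 ^ N / (2 * sqrt (1 - b) ^ M)"
  let ?w = "exp (\<theta> * t / 2) / (sqrt (1 - d) * sqrt (1 - f))"
  have b1: "b < 1" using r by simp
  have Z: "?z \<le> partition_function \<beta> N M x"
  proof -
    \<comment> \<open>One factor \<open>1 - \<delta>\<close> is lost in the covariance and another
      in the estimate of \<open>cosh\<close>, which explains the square in \<open>b\<close>.\<close>
    have "2 ^ card {1..N} / (2 * sqrt (1 - b) ^ card {1..M}) \<le>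
      (\<Sum>\<sigma>\<in>spins {1..N}. exp (\<beta> / real N / 2 * (\<Sum>\<nu>\<in>{1..M}. (spin_sum {1..N} x \<sigma> \<nu>)\<^sup>2)))"
    proof (rule sum_spins_exp_square_ge[where K = "real N * (1 - \<delta>)" and \<eta> = \<delta> and s = r])
      show "b = \<beta> / real N * (1 - \<delta>) * (real N * (1 - \<delta>))"
        using k b by (simp add: power2_eq_square)
      show "\<beta> / real N * R * (real (card {1..M}))\<^sup>2 \<le> \<tau>" using \<tau> by simp
    qed (use k M \<beta> \<delta> x nearly_isotropicD(2)[OF iso(3)] cosh r R in auto)
    then show ?thesis
      by (simp add: partition_function_def gibbs_weight_eq spin_configs_def)
  qed
  have zpos: "0 < ?z" using b1 by simp
  have "measure_pmf.prob ?p ?B \<le> 2 ^ N * ?w ^ M / partition_function \<beta> N M x"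
    unfolding prob_gibbs_marginal
    using gibbs_weight_sum_small_spin_sum[OF k \<beta> \<theta> iso(1,2) d f e, of t]
      partition_function_pos[of \<beta> N M x] by (intro divide_right_mono) auto
  also have "\<dots> \<le> 2 ^ N * ?w ^ M / ?z"
    using Z zpos d(2) f(2) by (intro divide_left_mono mult_pos_pos) (auto intro: order_less_le_trans)
  also have "\<dots> = 2 * (sqrt (1 - b) * ?w) ^ M"
    by (simp add: power_mult_distrib power_divide mult_ac)
  finally have pB: "measure_pmf.prob ?p ?B \<le> 2 * (sqrt (1 - b) * ?w) ^ M" .
  have "?B = UNIV - ?A" by auto
  then have pA: "measure_pmf.prob ?p ?B = 1 - measure_pmf.prob ?p ?A"
    using measure_pmf.prob_compl[of ?A ?p] by simp
  have qA: "measure_pmf.prob ?q ?A \<le> (exp (- s * t / 2) / sqrt (1 - s * (1 + \<delta>))) ^ M"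
    using prob_rademacher_large_spin_sum[OF k(1) _ iso(1) s, of t] by simp
  from pB pA qA tv_dist_ge[of ?p ?A ?q] show ?thesis by simp
qed

subsection \<open>Random patterns\<close>

context
  fixes N M :: nat and P :: "'a measure" and xi :: "nat \<Rightarrow> 'a \<Rightarrow> nat \<Rightarrow> real"
  assumes disorder: "hopfield_disorder N M P xi"
begin

interpretation prob_space P
  using disorder by (simp add: hopfield_disorder_def)

lemma disorder_measurable:
  assumes "i \<in> {1..N}"
  shows "xi i \<in> P \<rightarrow>\<^sub>M PiM {1..M} (\<lambda>\<nu>. count_space {-1, 1})"
  using disorder assms by (auto simp: hopfield_disorder_def indep_vars_def)

lemma disorder_values:
  assumes "i \<in> {1..N}" "\<nu> \<in> {1..M}" "\<omega> \<in> space P"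
  shows "xi i \<omega> \<nu> = -1 \<or> xi i \<omega> \<nu> = 1"
  using measurable_space[OF disorder_measurable[OF assms(1)] assms(3)] assms(2)
  by (auto simp: space_PiM PiE_iff)

text \<open>Passes from the discrete sigma-algebra on the two values to the Borel one, as needed for
  products and integrals.\<close>

lemma component_borel_measurable:
  assumes "\<nu> \<in> {1..M}"
  shows "(\<lambda>v. v \<nu>) \<in> borel_measurable (PiM {1..M} (\<lambda>\<nu>. count_space {-1, 1 :: real}))"
  by (rule measurable_compose[OF measurable_component_singleton[OF assms], where g = "\<lambda>x. x"]) simp

lemma disorder_borel_measurable:
  assumes "i \<in> {1..N}" "\<nu> \<in> {1..M}"
  shows "(\<lambda>\<omega>. xi i \<omega> \<nu>) \<in> borel_measurable P"
  using measurable_compose[OF disorder_measurable[OF assms(1)] component_borel_measurable[OF assms(2)]] .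

lemma integrable_disorder:
  assumes "i \<in> {1..N}" "\<nu> \<in> {1..M}"
  shows "integrable P (\<lambda>\<omega>. xi i \<omega> \<nu>)"
proof (rule integrable_const_bound[where B = 1])
  show "AE \<omega> in P. norm (xi i \<omega> \<nu>) \<le> 1"
    using disorder_values[OF assms] by (intro AE_I2) force
qed (rule disorder_borel_measurable[OF assms])

lemma expectation_disorder_product:
  assumes i: "i \<in> {1..N}" and \<nu>: "\<nu> \<in> {1..M}" "\<mu> \<in> {1..M}" "\<nu> \<noteq> \<mu>"
  shows "integrable P (\<lambda>\<omega>. xi i \<omega> \<nu> * xi i \<omega> \<mu>)"
    and "expectation (\<lambda>\<omega>. xi i \<omega> \<nu> * xi i \<omega> \<mu>) = 0"
proof -
  have "indep_vars (\<lambda>\<nu>. count_space {-1, 1}) (\<lambda>\<nu> \<omega>. xi i \<omega> \<nu>) {1..M}"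
    using disorder i by (auto simp: hopfield_disorder_def)
  then have "indep_vars (\<lambda>_. borel) (\<lambda>\<nu> \<omega>. xi i \<omega> \<nu>) {1..M}"
    by (rule indep_vars_compose2[where Y = "\<lambda>_ x. x"]) simp
  then have ind: "indep_vars (\<lambda>_. borel) (\<lambda>\<nu> \<omega>. xi i \<omega> \<nu>) {\<nu>, \<mu>}"
    by (rule indep_vars_subset) (use \<nu> in auto)
  have int: "integrable P (\<lambda>\<omega>. xi i \<omega> l)" if "l \<in> {\<nu>, \<mu>}" for l
    using integrable_disorder[OF i] that \<nu> by auto
  have mean: "expectation (\<lambda>\<omega>. xi i \<omega> \<nu>) = 0"
    using disorder i \<nu>(1) by (auto simp: hopfield_disorder_def)
  show "integrable P (\<lambda>\<omega>. xi i \<omega> \<nu> * xi i \<omega> \<mu>)"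
    using indep_vars_integrable[OF _ ind int] \<nu>(3) by simp
  show "expectation (\<lambda>\<omega>. xi i \<omega> \<nu> * xi i \<omega> \<mu>) = 0"
    using indep_vars_lebesgue_integral[OF _ ind int] \<nu>(3) mean by simp
qed

text \<open>For a fixed pair of coordinates, the products at distinct sites are independent and
  centred, while at a single site the square is identically 1: they are orthonormal.\<close>

lemma expectation_disorder_product_product:
  assumes i: "i \<in> {1..N}" "j \<in> {1..N}" and \<nu>: "\<nu> \<in> {1..M}" "\<mu> \<in> {1..M}" "\<nu> \<noteq> \<mu>"
  shows "integrable P (\<lambda>\<omega>. (xi i \<omega> \<nu> * xi i \<omega> \<mu>) * (xi j \<omega> \<nu> * xi j \<omega> \<mu>))" (is ?int)
    and "expectation (\<lambda>\<omega>. (xi i \<omega> \<nu> * xi i \<omega> \<mu>) * (xi j \<omega> \<nu> * xi j \<omega> \<mu>)) =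
      (if i = j then 1 else 0)" (is "?E = _")
proof -
  let ?Y = "\<lambda>i \<omega>. xi i \<omega> \<nu> * xi i \<omega> \<mu>"
  have "?int \<and> ?E = (if i = j then 1 else 0)"
  proof (cases "i = j")
    case True
    have one: "?Y i \<omega> * ?Y j \<omega> = 1" if "\<omega> \<in> space P" for \<omega>
      using disorder_values[OF i(1) \<nu>(1) that] disorder_values[OF i(1) \<nu>(2) that] True by auto
    have "?int \<longleftrightarrow> integrable P (\<lambda>_. 1 :: real)"
      by (rule Bochner_Integration.integrable_cong) (auto simp: one)
    moreover have "?E = expectation (\<lambda>_. 1)"
      by (rule Bochner_Integration.integral_cong) (auto simp: one)
    ultimately show ?thesis using True by (simp add: prob_space)
  next
    case False
    have "indep_vars (\<lambda>i. PiM {1..M} (\<lambda>\<nu>. count_space {-1, 1})) xi {1..N}"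
      using disorder by (auto simp: hopfield_disorder_def)
    then have "indep_vars (\<lambda>_. borel) ?Y {1..N}"
      by (rule indep_vars_compose2[where Y = "\<lambda>_ v. v \<nu> * v \<mu>"])
        (intro borel_measurable_times component_borel_measurable \<nu>)
    then have ind: "indep_vars (\<lambda>_. borel) ?Y {i, j}"
      by (rule indep_vars_subset) (use i in auto)
    have int: "integrable P (?Y l)" if "l \<in> {i, j}" for l
      using expectation_disorder_product(1)[OF _ \<nu>] that i by auto
    have "?int"
      using indep_vars_integrable[OF _ ind int] False by simp
    moreover have "?E = 0"
      using indep_vars_lebesgue_integral[OF _ ind int] False
        expectation_disorder_product(2)[OF i(1) \<nu>] by simp
    ultimately show ?thesis using False by simp
  qed
  then show ?int "?E = (if i = j then 1 else 0)" by blast+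
qed

text \<open>Expanding the squares, orthonormality leaves only the terms \<open>i = j\<close>, so
  each of the at most \<open>M\<^sup>2\<close> pairs contributes \<open>card I\<close>.\<close>

lemma expectation_pattern_correlation:
  assumes I: "I \<subseteq> {1..N}"
  shows "integrable P (\<lambda>\<omega>. pattern_correlation {1..M} I (\<lambda>i. xi i \<omega>))"
    and "expectation (\<lambda>\<omega>. pattern_correlation {1..M} I (\<lambda>i. xi i \<omega>)) \<le> (real M)\<^sup>2 * real (card I)"
proof -
  let ?O = "{p \<in> {1..M} \<times> {1..M}. fst p \<noteq> snd p}"
  let ?Y = "\<lambda>p i \<omega>. xi i \<omega> (fst p) * xi i \<omega> (snd p)"
  have fin: "finite I" using I finite_subset by blast
  have corr: "pattern_correlation {1..M} I (\<lambda>i. xi i \<omega>) =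
      (\<Sum>p\<in>?O. \<Sum>i\<in>I. \<Sum>j\<in>I. ?Y p i \<omega> * ?Y p j \<omega>)" for \<omega>
    by (simp add: pattern_correlation_def power2_eq_square sum_product)
  have int: "integrable P (\<lambda>\<omega>. ?Y p i \<omega> * ?Y p j \<omega>)"
    and E: "expectation (\<lambda>\<omega>. ?Y p i \<omega> * ?Y p j \<omega>) = (if i = j then 1 else 0)"
    if "p \<in> ?O" "i \<in> I" "j \<in> I" for p i j
    using expectation_disorder_product_product[of i j "fst p" "snd p"]
      subsetD[OF I that(2)] subsetD[OF I that(3)] that(1) by auto
  show "integrable P (\<lambda>\<omega>. pattern_correlation {1..M} I (\<lambda>i. xi i \<omega>))"
    unfolding corr by (intro Bochner_Integration.integrable_sum int)
  have "expectation (\<lambda>\<omega>. pattern_correlation {1..M} I (\<lambda>i. xi i \<omega>)) =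
      (\<Sum>p\<in>?O. \<Sum>i\<in>I. \<Sum>j\<in>I. if i = j then 1 else 0)"
    unfolding corr
    by (simp add: Bochner_Integration.integral_sum Bochner_Integration.integrable_sum int E
        del: mem_Collect_eq mem_Times_iff cong: sum.cong)
  also have "\<dots> = real (card ?O) * real (card I)"
    using fin by simp
  also have "\<dots> \<le> (real M)\<^sup>2 * real (card I)"
  proof (rule mult_right_mono)
    have "card ?O \<le> card ({1..M} \<times> {1..M})" by (rule card_mono) auto
    then show "real (card ?O) \<le> (real M)\<^sup>2"
      by (simp add: power2_eq_square flip: of_nat_mult)
  qed simp
  finally show "expectation (\<lambda>\<omega>. pattern_correlation {1..M} I (\<lambda>i. xi i \<omega>))
      \<le> (real M)\<^sup>2 * real (card I)" .
qed

text \<open>Markov's inequality for the pattern correlation. Near isotropy quantifies over all real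
  vectors \<open>g\<close>, so the failure event is enclosed in a measurable one instead of being
  shown measurable itself.\<close>

lemma prob_not_nearly_isotropic:
  assumes I: "I \<subseteq> {1..N}" "I \<noteq> {}" and \<delta>: "0 < \<delta>"
  obtains A where "A \<in> sets P" "{\<omega> \<in> space P. \<not> nearly_isotropic \<delta> {1..M} I (\<lambda>i. xi i \<omega>)} \<subseteq> A"
    "prob A \<le> (real M)\<^sup>2 / (\<delta>\<^sup>2 * real (card I))"
proof
  let ?c = "\<lambda>\<omega>. pattern_correlation {1..M} I (\<lambda>i. xi i \<omega>)"
  let ?A = "{\<omega> \<in> space P. ?c \<omega> \<ge> (\<delta> * real (card I))\<^sup>2}"
  have fin: "finite I" using I finite_subset by blast
  with I have pos: "0 < card I" by (simp add: card_gt_0_iff)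
  note int = expectation_pattern_correlation(1)[OF I(1)]
  show "?A \<in> sets P"
    using int by measurable
  show "{\<omega> \<in> space P. \<not> nearly_isotropic \<delta> {1..M} I (\<lambda>i. xi i \<omega>)} \<subseteq> ?A"
  proof
    fix \<omega> assume \<omega>: "\<omega> \<in> {\<omega> \<in> space P. \<not> nearly_isotropic \<delta> {1..M} I (\<lambda>i. xi i \<omega>)}"
    have "nearly_isotropic \<delta> {1..M} I (\<lambda>i. xi i \<omega>)" if "?c \<omega> \<le> (\<delta> * real (card I))\<^sup>2"
    proof (rule nearly_isotropicI[OF fin _ _ _ that])
      fix i \<nu> assume "i \<in> I" "\<nu> \<in> {1..M}"
      then show "(xi i \<omega> \<nu>)\<^sup>2 = 1"
        using disorder_values[of i \<nu> \<omega>] subsetD[OF I(1), of i] \<omega> by auto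
    qed (use \<delta> in auto)
    then show "\<omega> \<in> ?A" using \<omega> by force
  qed
  have "prob ?A \<le> expectation ?c / (\<delta> * real (card I))\<^sup>2"
    by (rule integral_Markov_inequality_measure[where A = "{}"])
      (use int pos \<delta> in \<open>auto simp: pattern_correlation_def intro!: sum_nonneg\<close>)
  also have "\<dots> \<le> ((real M)\<^sup>2 * real (card I)) / (\<delta> * real (card I))\<^sup>2"
    by (intro divide_right_mono expectation_pattern_correlation(2)[OF I(1)]) simp
  also have "\<dots> = (real M)\<^sup>2 / (\<delta>\<^sup>2 * real (card I))"
    using pos by (simp add: power2_eq_square)
  finally show "prob ?A \<le> (real M)\<^sup>2 / (\<delta>\<^sup>2 * real (card I))" .
qed

text \<open>The patterns at the sites \<open>1..N\<close> take finitely many values, and their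
  product sigma-algebra is discrete, so every function of them is measurable.\<close>

lemma disorder_function_measurable:
  fixes H :: "(nat \<Rightarrow> nat \<Rightarrow> real) \<Rightarrow> real"
  assumes H: "\<And>x y. (\<And>i. i \<in> {1..N} \<Longrightarrow> x i = y i) \<Longrightarrow> H x = H y"
  shows "(\<lambda>\<omega>. H (\<lambda>i. xi i \<omega>)) \<in> borel_measurable P"
proof -
  let ?C = "PiE {1..M} (\<lambda>_. {-1, 1 :: real})"
  have "PiM {1..M} (\<lambda>_. count_space {-1, 1 :: real}) = count_space ?C"
    by (rule count_space_PiM_finite) auto
  then have "(\<lambda>\<omega>. \<lambda>i\<in>{1..N}. xi i \<omega>) \<in> P \<rightarrow>\<^sub>M PiM {1..N} (\<lambda>_. count_space ?C)"
    using disorder_measurable by (intro measurable_restrict) simp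
  also have "PiM {1..N} (\<lambda>_. count_space ?C) = count_space (PiE {1..N} (\<lambda>_. ?C))"
    by (rule count_space_PiM_finite) (auto intro!: countable_finite finite_PiE)
  finally have "(\<lambda>\<omega>. H (\<lambda>i\<in>{1..N}. xi i \<omega>)) \<in> borel_measurable P"
    by (rule measurable_compose) simp
  moreover have "H (\<lambda>i\<in>{1..N}. xi i \<omega>) = H (\<lambda>i. xi i \<omega>)" for \<omega>
    by (rule H) simp
  ultimately show ?thesis by simp
qed

lemma tv_dist_gibbs_marginal_measurable:
  "(\<lambda>\<omega>. tv_dist (gibbs_marginal \<beta> N M k (\<lambda>i. xi i \<omega>)) (rademacher_product k)) \<in> borel_measurable P"
proof (rule disorder_function_measurable)
  fix x y :: "nat \<Rightarrow> nat \<Rightarrow> real"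
  assume "\<And>i. i \<in> {1..N} \<Longrightarrow> x i = y i"
  then have "overlap N x = overlap N y"
    by (intro ext) (simp add: overlap_def)
  then have "gibbs_weight \<beta> N M x = gibbs_weight \<beta> N M y"
    by (intro ext) (simp add: gibbs_weight_def)
  then have "gibbs_measure \<beta> N M x = gibbs_measure \<beta> N M y"
    unfolding gibbs_measure_def partition_function_def by (simp only:)
  then show "tv_dist (gibbs_marginal \<beta> N M k x) (rademacher_product k) =
      tv_dist (gibbs_marginal \<beta> N M k y) (rademacher_product k)"
    by (simp add: gibbs_marginal_def)
qed

end

subsection \<open>Choice of parameters and conclusion\<close>

text \<open>
  At \<open>\<delta> = 0\<close> the two bounds on quotients of square roots read \<open>exp (\<theta> t) < 1 + \<theta> / (1 - \<kappa>)\<close> and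
  \<open>exp (- s t) < 1 - s\<close>; to first order in \<open>\<theta>\<close> and \<open>s\<close> they say \<open>1 < t < 1 / (1 - \<kappa>)\<close>.
\<close>

lemma parameters_exist:
  fixes \<beta> \<rho> :: real
  assumes \<beta>: "0 < \<beta>" "\<beta> < 1" and \<rho>: "0 < \<rho>" "\<rho> < 1"
  obtains t \<theta> s \<delta> where "0 < \<theta>" "0 < s" "0 < \<delta>" "\<delta> < 1"
    "\<beta> * (1 + \<delta>) * (1 - \<rho>) < 1"
    "\<theta> < \<beta> * \<rho> / (1 - \<beta> * (1 + \<delta>) * (1 - \<rho>))"
    "(\<beta> * \<rho> / (1 - \<beta> * (1 + \<delta>) * (1 - \<rho>)) - \<theta>) * (1 + \<delta>) < 1"
    "sqrt (1 - \<beta> * (1 - \<delta>)\<^sup>2) * exp (\<theta> * t / 2) / (sqrt (1 - \<beta> * (1 + \<delta>) * (1 - \<rho>)) *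
      sqrt (1 - (\<beta> * \<rho> / (1 - \<beta> * (1 + \<delta>) * (1 - \<rho>)) - \<theta>) * (1 + \<delta>))) < 1"
    "s * (1 + \<delta>) < 1"
    "exp (- s * t / 2) / sqrt (1 - s * (1 + \<delta>)) < 1"
proof -
  define u where "u = 1 - \<beta> * (1 - \<rho>)"
  define \<kappa> where "\<kappa> = \<beta> * \<rho> / u"
  have "\<beta> * (1 - \<rho>) < 1 * 1"
    using \<beta> \<rho> by (intro mult_strict_mono) auto
  then have u: "0 < u" by (simp add: u_def)
  \<comment> \<open>This factorization of \<open>1 - \<beta>\<close> corresponds to summing out the
    last spins (factor \<open>u\<close>) and then the first ones (factor
    \<open>1 - \<kappa>\<close>).\<close>
  have \<kappa>u: "u * (1 - \<kappa>) = 1 - \<beta>"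
    using u by (simp add: \<kappa>_def u_def field_simps)
  have \<kappa>: "0 < \<kappa>" "\<kappa> < 1"
  proof -
    show "0 < \<kappa>" using u \<beta> \<rho> by (simp add: \<kappa>_def)
    from \<kappa>u \<beta> u have "0 < 1 - \<kappa>" by (metis diff_gt_0_iff_gt zero_less_mult_pos)
    then show "\<kappa> < 1" by simp
  qed
  then have "1 < 1 / (1 - \<kappa>)" by simp
  then obtain t where t: "1 < t" "t < 1 / (1 - \<kappa>)" using dense by blast
  have "\<forall>\<^sub>F \<theta> in at_right 0. 0 < \<theta> \<and> \<theta> < \<kappa> \<and> exp (t * \<theta>) < 1 + 1 / (1 - \<kappa>) * \<theta>"
    using eventually_exp_less_affine[OF t(2)] eventually_at_right_less[of "0::real"]
      eventually_at_right_real[OF \<kappa>(1)]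
    by eventually_elim auto
  then obtain \<theta> where \<theta>: "0 < \<theta>" "\<theta> < \<kappa>" "exp (t * \<theta>) < 1 + 1 / (1 - \<kappa>) * \<theta>"
    using eventually_happens by force
  have "\<forall>\<^sub>F s in at_right 0. 0 < s \<and> s < 1 \<and> exp (- t * s) < 1 + (- 1) * s"
    using eventually_exp_less_affine[of "- t" "- 1", simplified, OF t(1)]
      eventually_at_right_real[OF zero_less_one]
    by eventually_elim auto
  then obtain s where s: "0 < s" "s < 1" "exp (- t * s) < 1 - s"
    using eventually_happens by force
  \<comment> \<open>With \<open>t\<close>, \<open>\<theta>\<close> and \<open>s\<close> fixed, all
    required inequalities are strict in the limit of \<open>\<delta>\<close> to 0 and hence persist
    for small positive \<open>\<delta>\<close>.\<close>
  let ?D = "\<lambda>\<delta>. \<beta> * (1 + \<delta>) * (1 - \<rho>)"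
  let ?E = "\<lambda>\<delta>. \<beta> * \<rho> / (1 - ?D \<delta>)"
  let ?F = "\<lambda>\<delta>. (?E \<delta> - \<theta>) * (1 + \<delta>)"
  let ?W = "\<lambda>\<delta>. sqrt (1 - \<beta> * (1 - \<delta>)\<^sup>2) * exp (\<theta> * t / 2) / (sqrt (1 - ?D \<delta>) * sqrt (1 - ?F \<delta>))"
  let ?S = "\<lambda>\<delta>. exp (- s * t / 2) / sqrt (1 - s * (1 + \<delta>))"
  have D: "(?D \<longlongrightarrow> \<beta> * (1 + 0) * (1 - \<rho>)) (at_right 0)"
    by (intro tendsto_intros)
  then have D: "(?D \<longlongrightarrow> 1 - u) (at_right 0)" by (simp add: u_def)
  have "(?E \<longlongrightarrow> \<beta> * \<rho> / (1 - (1 - u))) (at_right 0)"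
    by (intro tendsto_intros D) (use u in simp)
  then have E: "(?E \<longlongrightarrow> \<kappa>) (at_right 0)" by (simp add: \<kappa>_def)
  have "(?F \<longlongrightarrow> (\<kappa> - \<theta>) * (1 + 0)) (at_right 0)"
    by (intro tendsto_intros E)
  then have F: "(?F \<longlongrightarrow> \<kappa> - \<theta>) (at_right 0)" by simp
  have "(?W \<longlongrightarrow> sqrt (1 - \<beta> * (1 - 0)\<^sup>2) * exp (\<theta> * t / 2) /
      (sqrt (1 - (1 - u)) * sqrt (1 - (\<kappa> - \<theta>)))) (at_right 0)"
    by (intro tendsto_intros D F) (use u \<kappa> \<theta> in auto)
  moreover have "sqrt (1 - \<beta> * (1 - 0)\<^sup>2) * exp (\<theta> * t / 2) /
      (sqrt (1 - (1 - u)) * sqrt (1 - (\<kappa> - \<theta>))) < 1"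
  proof -
    \<comment> \<open>The claim is squared to remove the roots; the factorization of
      \<open>1 - \<beta>\<close> then identifies the bound on the right.\<close>
    have "exp (\<theta> * t) * (1 - \<beta>) < (1 + 1 / (1 - \<kappa>) * \<theta>) * (1 - \<beta>)"
      using \<theta>(3) \<beta> by (intro mult_strict_right_mono) (auto simp: mult.commute)
    also have "\<dots> = u * (1 - (\<kappa> - \<theta>))"
      using \<kappa> unfolding \<kappa>u[symmetric] by (simp add: field_simps)
    finally have "sqrt (exp (\<theta> * t) * (1 - \<beta>)) < sqrt (u * (1 - (\<kappa> - \<theta>)))"
      by (rule real_sqrt_less_mono)
    moreover have "sqrt (exp (\<theta> * t)) = exp (\<theta> * t / 2)"
      by (rule real_sqrt_unique) (simp_all flip: exp_double)
    ultimately have "exp (\<theta> * t / 2) * sqrt (1 - \<beta>) < sqrt u * sqrt (1 - (\<kappa> - \<theta>))"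
      by (simp add: real_sqrt_mult)
    then show ?thesis
      using u \<kappa> \<theta> by (simp add: divide_less_eq mult.commute)
  qed
  ultimately have W: "\<forall>\<^sub>F \<delta> in at_right 0. ?W \<delta> < 1" by (rule order_tendstoD(2))
  have "(?S \<longlongrightarrow> exp (- s * t / 2) / sqrt (1 - s * (1 + 0))) (at_right 0)"
    by (intro tendsto_intros) (use s in auto)
  moreover have "exp (- s * t / 2) / sqrt (1 - s * (1 + 0)) < 1"
  proof -
    have root: "sqrt (exp (- t * s)) = exp (- s * t / 2)"
      by (rule real_sqrt_unique) (simp_all add: mult.commute flip: exp_double)
    have "exp (- s * t / 2) < sqrt (1 - s)"
      using real_sqrt_less_mono[OF s(3)] unfolding root .
    then show ?thesis using s by (simp add: divide_less_eq)
  qed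
  ultimately have S: "\<forall>\<^sub>F \<delta> in at_right 0. ?S \<delta> < 1" by (rule order_tendstoD(2))
  have "((\<lambda>\<delta>. s * (1 + \<delta>)) \<longlongrightarrow> s * (1 + 0)) (at_right 0)"
    by (intro tendsto_intros)
  then have s1: "\<forall>\<^sub>F \<delta> in at_right 0. s * (1 + \<delta>) < 1"
    by (rule order_tendstoD(2)) (use s in simp)
  have "\<forall>\<^sub>F \<delta> in at_right 0. (0 < \<delta> \<and> \<delta> < 1) \<and> ?D \<delta> < 1 \<and> \<theta> < ?E \<delta> \<and> ?F \<delta> < 1 \<and>
      ?W \<delta> < 1 \<and> s * (1 + \<delta>) < 1 \<and> ?S \<delta> < 1"
    using eventually_at_right_real[of "0::real" 1] order_tendstoD(2)[OF D, of 1]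
      order_tendstoD(1)[OF E \<theta>(2)] order_tendstoD(2)[OF F, of 1] W s1 S u \<kappa> \<theta>
    by (auto intro!: eventually_conj elim: eventually_mono)
  then obtain \<delta> where "(0 < \<delta> \<and> \<delta> < 1) \<and> ?D \<delta> < 1 \<and> \<theta> < ?E \<delta> \<and> ?F \<delta> < 1 \<and>
      ?W \<delta> < 1 \<and> s * (1 + \<delta>) < 1 \<and> ?S \<delta> < 1"
    using eventually_happens by force
  then show thesis using \<theta>(1) s(1) by (intro that[of \<theta> s \<delta> t]) auto
qed

text \<open>With \<open>v = y\<^sup>2 / 2\<close>, the exponential
  \<open>exp ((1 - \<delta>) * v)\<close> lies below \<open>1 + v\<close> for small positive
  \<open>v\<close>, and \<open>1 + v\<close> is at most \<open>cosh y\<close>.\<close>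

lemma cosh_ge_near_zero:
  fixes \<delta> :: real
  assumes "0 < \<delta>"
  obtains \<tau> where "0 < \<tau>" "\<And>y. y\<^sup>2 \<le> \<tau> \<Longrightarrow> exp ((1 - \<delta>) * (y\<^sup>2 / 2)) \<le> cosh y"
proof -
  from eventually_exp_less_affine[of "1 - \<delta>" 1] assms obtain \<tau> where \<tau>: "0 < \<tau>"
    "\<And>v. 0 < v \<Longrightarrow> v < \<tau> \<Longrightarrow> exp ((1 - \<delta>) * v) < 1 + 1 * v"
    unfolding eventually_at_right_field by auto
  show thesis
  proof (rule that[OF \<tau>(1)])
    fix y :: real assume y: "y\<^sup>2 \<le> \<tau>"
    show "exp ((1 - \<delta>) * (y\<^sup>2 / 2)) \<le> cosh y"
    proof (cases "y = 0")
      case False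
      then have "0 < y\<^sup>2 / 2" "y\<^sup>2 / 2 < \<tau>" using y \<tau>(1) by auto
      from \<tau>(2)[OF this] one_plus_half_square_le_cosh[of y] show ?thesis by simp
    qed simp
  qed
qed

lemma tail_radius_exists:
  fixes b r :: real
  assumes "b + r < 1" "0 < r"
  obtains R where "2 * sqrt (1 - b) * exp (- r * R / 2) \<le> sqrt (1 - b - r)"
proof -
  have "((\<lambda>R. 2 * sqrt (1 - b) * exp (- r * R / 2)) \<longlongrightarrow> 0) at_top"
    using assms(2) by real_asymp
  from order_tendstoD(2)[OF this, of "sqrt (1 - b - r)"] assms(1)
  have "\<forall>\<^sub>F R in at_top. 2 * sqrt (1 - b) * exp (- r * R / 2) < sqrt (1 - b - r)" by simp
  then obtain R where "2 * sqrt (1 - b) * exp (- r * R / 2) < sqrt (1 - b - r)"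
    using eventually_happens by force
  then show thesis by (intro that[of R]) simp
qed

theorem theorem1p2:
  fixes \<beta> \<rho> :: real
    and M k :: "nat \<Rightarrow> nat"
    and P :: "nat \<Rightarrow> 'a measure"
    and xi :: "nat \<Rightarrow> nat \<Rightarrow> 'a \<Rightarrow> nat \<Rightarrow> real"
  assumes beta: "0 < \<beta>" "\<beta> < 1"
    and M_infinity: "filterlim M at_top at_top"
    and M_small: "(\<lambda>N. real (M N)) \<in> o(\<lambda>N. sqrt (real N))"
    and rho: "0 < \<rho>" "\<rho> < 1"
    and k_ratio: "(\<lambda>N. real (k N) / real N) \<longlonglongrightarrow> \<rho>"
    and disorder: "\<And>N. hopfield_disorder N (M N) (P N) (xi N)"
  shows "tendsto_in_prob P
           (\<lambda>N \<omega>. tv_dist (gibbs_marginal \<beta> N (M N) (k N) (\<lambda>i. xi N i \<omega>))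
                           (rademacher_product (k N)))
           1"
proof -
  let ?X = "\<lambda>N \<omega>. tv_dist (gibbs_marginal \<beta> N (M N) (k N) (\<lambda>i. xi N i \<omega>)) (rademacher_product (k N))"
  obtain t \<theta> s \<delta> where par: "0 < \<theta>" "0 < s" "0 < \<delta>" "\<delta> < 1"
    and D_less: "\<beta> * (1 + \<delta>) * (1 - \<rho>) < 1"
    and E_gr: "\<theta> < \<beta> * \<rho> / (1 - \<beta> * (1 + \<delta>) * (1 - \<rho>))"
    and F_less: "(\<beta> * \<rho> / (1 - \<beta> * (1 + \<delta>) * (1 - \<rho>)) - \<theta>) * (1 + \<delta>) < 1"
    and W_less: "sqrt (1 - \<beta> * (1 - \<delta>)\<^sup>2) * exp (\<theta> * t / 2) / (sqrt (1 - \<beta> * (1 + \<delta>) * (1 - \<rho>)) *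
      sqrt (1 - (\<beta> * \<rho> / (1 - \<beta> * (1 + \<delta>) * (1 - \<rho>)) - \<theta>) * (1 + \<delta>))) < 1"
    and s1: "s * (1 + \<delta>) < 1"
    and S_less: "exp (- s * t / 2) / sqrt (1 - s * (1 + \<delta>)) < 1"
    using parameters_exist[OF beta rho] by metis
  obtain \<tau> where \<tau>: "0 < \<tau>" and cosh: "\<And>y. y\<^sup>2 \<le> \<tau> \<Longrightarrow> exp ((1 - \<delta>) * (y\<^sup>2 / 2)) \<le> cosh y"
    using cosh_ge_near_zero[OF par(3)] by blast
  define b where "b = \<beta> * (1 - \<delta>)\<^sup>2"
  have "b < 1 * 1"
    unfolding b_def using beta par by (intro mult_less_le_imp_less) (auto simp: power_le_one)
  then have b: "b < 1" by simp
  \<comment> \<open>Any tilt strictly between 0 and \<open>1 - b\<close> would do; the midpoint is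
    taken.\<close>
  define r where "r = (1 - b) / 2"
  have r: "0 < r" "b + r < 1" using b by (simp_all add: r_def field_simps)
  obtain R where R: "2 * sqrt (1 - b) * exp (- r * R / 2) \<le> sqrt (1 - b - r)"
    using tail_radius_exists[OF r(2,1)] .
  \<comment> \<open>The quantities at finite \<open>N\<close> have \<open>k N / N\<close> in place
    of \<open>\<rho>\<close> and converge to those in the choice of parameters.\<close>
  define u where "u = (\<lambda>N. real (k N) / real N)"
  define d where "d = (\<lambda>N. \<beta> * (1 + \<delta>) * (1 - u N))"
  define e where "e = (\<lambda>N. \<beta> * u N / (1 - d N))"
  define f where "f = (\<lambda>N. (e N - \<theta>) * (1 + \<delta>))"
  define W where "W = (\<lambda>N. sqrt (1 - b) * exp (\<theta> * t / 2) / (sqrt (1 - d N) * sqrt (1 - f N)))"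
  define S where "S = exp (- s * t / 2) / sqrt (1 - s * (1 + \<delta>))"
  have u_lim: "u \<longlonglongrightarrow> \<rho>" unfolding u_def by (rule k_ratio)
  have d_lim: "d \<longlonglongrightarrow> \<beta> * (1 + \<delta>) * (1 - \<rho>)"
    unfolding d_def by (intro tendsto_intros u_lim)
  have e_lim: "e \<longlonglongrightarrow> \<beta> * \<rho> / (1 - \<beta> * (1 + \<delta>) * (1 - \<rho>))"
    unfolding e_def by (intro tendsto_intros u_lim d_lim) (use D_less in simp)
  have f_lim: "f \<longlonglongrightarrow> (\<beta> * \<rho> / (1 - \<beta> * (1 + \<delta>) * (1 - \<rho>)) - \<theta>) * (1 + \<delta>)"
    unfolding f_def by (intro tendsto_intros e_lim)
  \<comment> \<open>A fixed base between the limit of \<open>W\<close> and 1: eventually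
    \<open>W N < w\<close>, so the powers \<open>W N ^ M N\<close> are dominated by
    \<open>w ^ M N\<close>, which tends to 0.\<close>
  obtain w where w: "sqrt (1 - b) * exp (\<theta> * t / 2) / (sqrt (1 - \<beta> * (1 + \<delta>) * (1 - \<rho>)) *
      sqrt (1 - (\<beta> * \<rho> / (1 - \<beta> * (1 + \<delta>) * (1 - \<rho>)) - \<theta>) * (1 + \<delta>))) < w" "w < 1"
    using dense[OF W_less] unfolding b_def by blast
  have W_lim: "W \<longlonglongrightarrow> sqrt (1 - b) * exp (\<theta> * t / 2) / (sqrt (1 - \<beta> * (1 + \<delta>) * (1 - \<rho>)) *
      sqrt (1 - (\<beta> * \<rho> / (1 - \<beta> * (1 + \<delta>) * (1 - \<rho>)) - \<theta>) * (1 + \<delta>)))"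
    unfolding W_def by (intro tendsto_intros d_lim f_lim) (use D_less F_less in auto)
  \<comment> \<open>The growth condition on \<open>M\<close> enters here. It serves twice: to keep
    the arguments of \<open>cosh\<close> small up to the cutoff, and to make failures of near
    isotropy unlikely.\<close>
  have "(\<lambda>N. (real (M N) / sqrt (real N))\<^sup>2) \<longlonglongrightarrow> 0\<^sup>2"
    by (intro tendsto_power smalloD_tendsto[OF M_small])
  then have M2: "(\<lambda>N. (real (M N))\<^sup>2 / real N) \<longlonglongrightarrow> 0"
    by (simp add: power_divide)
  have "(\<lambda>N. \<beta> * R * ((real (M N))\<^sup>2 / real N)) \<longlonglongrightarrow> \<beta> * R * 0"
    by (intro tendsto_intros M2)
  then have \<tau>_ev: "\<forall>\<^sub>F N in sequentially. \<beta> * R * ((real (M N))\<^sup>2 / real N) < \<tau>"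
    using \<tau> by (intro order_tendstoD(2)) auto
  \<comment> \<open>The sum of the three Markov bounds, for the first \<open>k N\<close>, the last
    \<open>N - k N\<close> and all \<open>N\<close> sites.\<close>
  define q where "q = (\<lambda>N. (real (M N))\<^sup>2 / real N / (\<delta>\<^sup>2 * u N) +
    (real (M N))\<^sup>2 / real N / (\<delta>\<^sup>2 * (1 - u N)) + (real (M N))\<^sup>2 / real N / \<delta>\<^sup>2)"
  have "q \<longlonglongrightarrow> 0 / (\<delta>\<^sup>2 * \<rho>) + 0 / (\<delta>\<^sup>2 * (1 - \<rho>)) + 0 / \<delta>\<^sup>2"
    unfolding q_def by (intro tendsto_intros M2 u_lim) (use par rho in auto)
  then have q_lim: "q \<longlonglongrightarrow> 0" by simp
  have w0: "0 \<le> w"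
    using W_lim w D_less F_less b
    by (intro order_trans[OF _ less_imp_le[OF w(1)]] divide_nonneg_nonneg mult_nonneg_nonneg) auto
  have S: "0 \<le> S" "S < 1" using S_less s1 by (auto simp: S_def)
  have "(\<lambda>n. 2 * w ^ n + S ^ n) \<longlonglongrightarrow> 2 * 0 + 0"
    by (intro tendsto_intros LIMSEQ_power_zero) (use w0 w S in auto)
  from filterlim_compose[OF this M_infinity]
  have error: "(\<lambda>N. 2 * w ^ M N + S ^ M N) \<longlonglongrightarrow> 0" by simp
  have deviation: "(\<lambda>N. measure (P N) {\<omega> \<in> space (P N). \<bar>?X N \<omega> - 1\<bar> > \<epsilon>}) \<longlonglongrightarrow> 0"
    if \<epsilon>: "\<epsilon> > 0" for \<epsilon>
  proof (rule tendsto_sandwich[OF _ _ tendsto_const q_lim])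
    show "\<forall>\<^sub>F N in sequentially.
        measure (P N) {\<omega> \<in> space (P N). \<bar>?X N \<omega> - 1\<bar> > \<epsilon>} \<le> q N"
      using order_tendstoD(1)[OF u_lim rho(1)] order_tendstoD(2)[OF u_lim rho(2)]
        order_tendstoD(2)[OF d_lim D_less] order_tendstoD(1)[OF e_lim E_gr]
        order_tendstoD(2)[OF f_lim F_less] order_tendstoD(2)[OF W_lim w(1)] \<tau>_ev
        order_tendstoD(2)[OF error \<epsilon>] eventually_gt_at_top[of 0]
        eventually_compose_filterlim[OF eventually_gt_at_top[of 0] M_infinity]
    proof eventually_elim
      case (elim N)
      let ?x = "\<lambda>\<omega> i. xi N i \<omega>"
      let ?bad = "\<lambda>I. {\<omega> \<in> space (P N). \<not> nearly_isotropic \<delta> {1..M N} I (?x \<omega>)}"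
      interpret prob_space "P N"
        using disorder[of N] by (simp add: hopfield_disorder_def)
      have k: "0 < k N" "k N < N"
        using elim(1,2,9) by (auto simp: u_def zero_less_divide_iff divide_less_eq)
      obtain A1 where A1: "A1 \<in> sets (P N)" "?bad {1..k N} \<subseteq> A1"
        "prob A1 \<le> (real (M N))\<^sup>2 / (\<delta>\<^sup>2 * real (card {1..k N}))"
        using prob_not_nearly_isotropic[OF disorder[of N] _ _ par(3), of "{1..k N}"] k by auto
      obtain A2 where A2: "A2 \<in> sets (P N)" "?bad {k N + 1..N} \<subseteq> A2"
        "prob A2 \<le> (real (M N))\<^sup>2 / (\<delta>\<^sup>2 * real (card {k N + 1..N}))"
        using prob_not_nearly_isotropic[OF disorder[of N] _ _ par(3), of "{k N + 1..N}"] k by auto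
      obtain A3 where A3: "A3 \<in> sets (P N)" "?bad {1..N} \<subseteq> A3"
        "prob A3 \<le> (real (M N))\<^sup>2 / (\<delta>\<^sup>2 * real (card {1..N}))"
        using prob_not_nearly_isotropic[OF disorder[of N] _ _ par(3), of "{1..N}"] k by auto
      \<comment> \<open>Off the exceptional events the estimate is deterministic, so randomness
        enters only through near isotropy. As the distance never exceeds 1, a lower bound on it
        suffices.\<close>
      have good: "\<bar>?X N \<omega> - 1\<bar> \<le> \<epsilon>" if \<omega>: "\<omega> \<in> space (P N)" "\<omega> \<notin> A1 \<union> A2 \<union> A3" for \<omega>
      proof -
        have iso: "nearly_isotropic \<delta> {1..M N} {1..k N} (?x \<omega>)"
          "nearly_isotropic \<delta> {1..M N} {k N + 1..N} (?x \<omega>)"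
          "nearly_isotropic \<delta> {1..M N} {1..N} (?x \<omega>)"
          using \<omega> A1(2) A2(2) A3(2) by blast+
        have "1 - 2 * W N ^ M N - S ^ M N \<le> ?X N \<omega>"
          unfolding W_def S_def
        proof (rule tv_dist_gibbs_marginal_ge[OF k elim(10) beta(1) _ _ iso, where \<tau> = \<tau> and R = R and r = r])
          fix i \<nu> assume "i \<in> {1..N}" "\<nu> \<in> {1..M N}"
          from disorder_values[OF disorder[of N] this \<omega>(1)] show "(xi N i \<omega> \<nu>)\<^sup>2 = 1" by auto
        next
          show "\<beta> / real N * R * (real (M N))\<^sup>2 \<le> \<tau>" using elim(7) by simp
        qed (use par cosh R r s1 elim in \<open>simp_all add: d_def e_def f_def u_def b_def\<close>)
        moreover have "W N ^ M N \<le> w ^ M N"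
          using elim(3,5,6) b by (intro power_mono) (auto simp: W_def intro!: divide_nonneg_nonneg)
        ultimately have "1 - \<epsilon> < ?X N \<omega>" using elim(8) by simp
        then show ?thesis
          using tv_dist_le_1[of "gibbs_marginal \<beta> N (M N) (k N) (?x \<omega>)" "rademacher_product (k N)"]
          by linarith
      qed
      have "prob {\<omega> \<in> space (P N). \<bar>?X N \<omega> - 1\<bar> > \<epsilon>} \<le> prob (A1 \<union> A2 \<union> A3)"
        by (rule finite_measure_mono) (use good A1(1) A2(1) A3(1) in \<open>auto simp: not_less[symmetric]\<close>)
      also have "\<dots> \<le> prob A1 + prob A2 + prob A3"
        using measure_Un_le[of "A1 \<union> A2" "P N" A3] measure_Un_le[of A1 "P N" A2]
          A1(1) A2(1) A3(1) by auto
      also have "\<dots> \<le> (real (M N))\<^sup>2 / (\<delta>\<^sup>2 * real (k N)) +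
          (real (M N))\<^sup>2 / (\<delta>\<^sup>2 * (real N - real (k N))) + (real (M N))\<^sup>2 / (\<delta>\<^sup>2 * real N)"
        using A1(3) A2(3) A3(3) k by (simp add: of_nat_diff)
      also have "\<dots> = q N"
      proof -
        \<comment> \<open>These identities rewrite the block sizes as multiples of \<open>N\<close>,
          matching the denominators in \<open>q\<close>.\<close>
        have sizes: "real N * u N = real (k N)" "real N * (1 - u N) = real N - real (k N)"
          using k by (simp_all add: u_def right_diff_distrib)
        show ?thesis
          unfolding q_def divide_divide_eq_left
          by (simp only: mult.left_commute[of "real N" "\<delta>\<^sup>2"] mult.commute[of "real N" "\<delta>\<^sup>2"] sizes)
      qed
      finally show ?case .
    qed
  qed simp
  show ?thesis
    unfolding tendsto_in_prob_def
    using tv_dist_gibbs_marginal_measurable[OF disorder] deviation by blast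
qed

end
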